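(* Let $\sigma\colon\Gamma\to2^V$ be a quasi-geometric homology triangulation of a simplex, $n=|V|$, and let $E\subset E'$ be faces of $\Gamma$, with $d=n-|E|$, $d'=n-|E'|$ and $b'=n-|\sigma(E')|$. Let $\theta_1,\ldots,\theta_d$ be a special l.s.o.p. for $k[\mathrm{lk}_\Gamma(E)]$, let $\mathrm{Star}(E'\smallsetminus E)$ be the closed star of $E'\smallsetminus E$ in $\mathrm{lk}_\Gamma(E)$, and let $\theta_i'$ be the image of $\theta_i$ under the restriction map $k[\mathrm{lk}_\Gamma(E)]\to k[\mathrm{Star}(E'\smallsetminus E)]$. Identify $k[\mathrm{lk}_\Gamma(E')]$ with the subalgebra of $k[\mathrm{Star}(E'\smallsetminus E)]$ supported on $\mathrm{lk}_\Gamma(E')$ (and view $k[\mathrm{lk}_\Gamma(E)]$ as a $k[\mathrm{lk}_\Gamma(E')]$-algebra via $x^F\mapsto x^F$). Then there is a unique homomorphism of graded $k[\mathrm{lk}_\Gamma(E')]$-algebras $$\phi\colon k[\mathrm{lk}_\Gamma(E)]/(\theta_1,\ldots,\theta_d)\to k[\mathrm{lk}_\Gamma(E')]/\big(k[\mathrm{lk}_\Gamma(E')]\cap(\theta_1',\ldots,\theta_d')\big)$$ whose kernel contains $\{[x^F]: F\notin\mathrm{Star}(E'\smallsetminus E)\}$, where $(\theta_1',\ldots,\theta_d')$ is the ideal of $k[\mathrm{Star}(E'\smallsetminus E)]$. Moreover, there is a special l.s.o.p. $\zeta_1,\ldots,\zeta_{d'}$ for $k[\mathrm{lk}_\Gamma(E')]$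 such that $(\zeta_1,\ldots,\zeta_{d'})=k[\mathrm{lk}_\Gamma(E')]\cap(\theta_1',\ldots,\theta_d')$ and, after reordering the $\theta_i$, $\theta_i|_{\mathrm{lk}_\Gamma(E')}=\zeta_i$ for $1\le i\le b'$. With this choice of special l.s.o.p. (used to define $L(\Gamma,E')$), $\phi(L(\Gamma,E))\subset L(\Gamma,E')$.
   Context: Fix an infinite field $k$; homology is with coefficients in $k$. A $d$-dimensional simplicial complex $\Gamma$ with trivial reduced homology is a homology ball of dimension $d$ if there is a subcomplex $\partial\Gamma$ such that $\partial\Gamma$ is a homology sphere of dimension $d-1$, $\mathrm{lk}_\Gamma(F)$ is a homology sphere of dimension $d-|F|$ for $F\notin\partial\Gamma$, and $\mathrm{lk}_\Gamma(F)$ is a homology ball of dimension $d-|F|$ for nonempty $F\in\partial\Gamma$; its interior faces are those not in $\partial\Gamma$. A homology triangulation of $2^V$ is a finite simplicial complex $\Gamma$ with $\sigma\colon\Gamma\to2^V$ such that for every nonempty $U\subset V$, $\Gamma_U:=\sigma^{-1}(2^U)$ is a homology ball of dimension $|U|-1$ whose interior faces are exactly $\sigma^{-1}(U)$. $\sigma(F)$ is the carrier; $\sigma(w)=\sigma(\{w\})$. It is quasi-geometric if there is no face $F$ and $U\subset V$ with $\dim\Gamma_U<\dim F$ and $\sigma(w)\subset U$ for all vertices $w\in F$. A face $G$ is interior if $\sigma(G)=V$. $k[\Delta]$ is the face ring of $\Delta$ (variables $x_w$, $x^F=\prod_{w\in F}x_w$), graded by degree; for a subcomplex $\Delta'\subset\Delta$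 the restriction map $k[\Delta]\to k[\Delta']$ sends $x^F$ to $x^F$ if $F\in\Delta'$ and to $0$ otherwise, written $\theta\mapsto\theta|_{\Delta'}$. The support of $\sum a_wx_w$ is $\{w:a_w\ne0\}$. An l.s.o.p. for a finitely generated graded $k$-algebra of Krull dimension $d$ is a sequence of $d$ degree-one elements with finite-dimensional quotient. For a face $E$, an l.s.o.p. $\theta_1,\ldots,\theta_d$ of $k[\mathrm{lk}_\Gamma(E)]$ ($d=|V|-|E|$) is special if for each $v\in V\smallsetminus\sigma(E)$ there is an element $\theta_v$ of it supported on vertices $w$ of $\mathrm{lk}_\Gamma(E)$ with $v\in\sigma(w)$, with $\theta_v\ne\theta_{v'}$ for $v\ne v'$. The local face module $L(\Gamma,E)$ (with respect to a special l.s.o.p.) is the image of the ideal $(x^F:F\in\mathrm{lk}_\Gamma(E),\ F\sqcup E\text{ interior})$ in $k[\mathrm{lk}_\Gamma(E)]/(\theta_1,\ldots,\theta_d)$. *)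

theory Defs
  imports Main "HOL-Library.Multiset"
begin

definition simplicial_complex :: "'w set set \<Rightarrow> bool" where
  "simplicial_complex \<Delta> \<longleftrightarrow> finite \<Delta> \<and> {} \<in> \<Delta> \<and> (\<forall>F\<in>\<Delta>. \<forall>G. G \<subseteq> F \<longrightarrow> G \<in> \<Delta>)"

definition cdim :: "'w set set \<Rightarrow> int" where
  "cdim \<Delta> = int (Max (card ` \<Delta>)) - 1"

definition link :: "'w set set \<Rightarrow> 'w set \<Rightarrow> 'w set set" where
  "link \<Delta> F = {G \<in> \<Delta>. G \<inter> F = {} \<and> G \<union> F \<in> \<Delta>}"

definition cstar :: "'w set set \<Rightarrow> 'w set \<Rightarrow> 'w set set" where
  "cstar \<Delta> A = {G \<in> \<Delta>. G \<union> A \<in> \<Delta>}"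

definition vertices :: "'w set set \<Rightarrow> 'w set" where
  "vertices \<Delta> = {w. {w} \<in> \<Delta>}"

text \<open>Chains supported on faces of cardinality q (i.e. of dimension q-1; q = 0 is the
augmentation degree -1, spanned by the empty face). Faces are oriented by the linear
order on the vertex type.\<close>

definition is_chain :: "'w set set \<Rightarrow> nat \<Rightarrow> ('w set \<Rightarrow> 'k::field) \<Rightarrow> bool" where
  "is_chain \<Delta> q c \<longleftrightarrow> (\<forall>F. c F \<noteq> 0 \<longrightarrow> F \<in> \<Delta> \<and> card F = q)"

definition bd :: "'w::linorder set set \<Rightarrow> ('w set \<Rightarrow> 'k::field) \<Rightarrow> 'w set \<Rightarrow> 'k" where
  "bd \<Delta> c G = (\<Sum>v\<in>{v \<in> \<Union>\<Delta>. v \<notin> G \<and> insert v G \<in> \<Delta>}.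
                  (-1) ^ (card {u \<in> G. u < v}) * c (insert v G))"

definition acyclic_at :: "'k::field itself \<Rightarrow> 'w::linorder set set \<Rightarrow> nat \<Rightarrow> bool" where
  "acyclic_at K \<Delta> q \<longleftrightarrow>
     (\<forall>c :: 'w set \<Rightarrow> 'k. is_chain \<Delta> q c \<and> bd \<Delta> c = (\<lambda>_. 0) \<longrightarrow>
        (\<exists>b. is_chain \<Delta> (Suc q) b \<and> bd \<Delta> b = c))"

definition rank_one_at :: "'k::field itself \<Rightarrow> 'w::linorder set set \<Rightarrow> nat \<Rightarrow> bool" where
  "rank_one_at K \<Delta> q \<longleftrightarrow>
     (\<exists>z :: 'w set \<Rightarrow> 'k. is_chain \<Delta> q z \<and> bd \<Delta> z = (\<lambda>_. 0) \<and>
        \<not> (\<exists>b. is_chain \<Delta> (Suc q) b \<and> bd \<Delta> b = z) \<and>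
        (\<forall>c. is_chain \<Delta> q c \<and> bd \<Delta> c = (\<lambda>_. 0) \<longrightarrow>
           (\<exists>a b. is_chain \<Delta> (Suc q) b \<and> bd \<Delta> b = (\<lambda>F. c F - a * z F))))"

definition acyclic :: "'k::field itself \<Rightarrow> 'w::linorder set set \<Rightarrow> bool" where
  "acyclic K \<Delta> \<longleftrightarrow> (\<forall>q. acyclic_at K \<Delta> q)"

definition sphere_homology :: "'k::field itself \<Rightarrow> 'w::linorder set set \<Rightarrow> int \<Rightarrow> bool" where
  "sphere_homology K \<Delta> i \<longleftrightarrow>
     (\<forall>q::nat. (int q = i + 1 \<longrightarrow> rank_one_at K \<Delta> q) \<and> (int q \<noteq> i + 1 \<longrightarrow> acyclic_at K \<Delta> q))"

definition homology_sphere :: "'k::field itself \<Rightarrow> 'w::linorder set set \<Rightarrow> int \<Rightarrow> bool" where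
  "homology_sphere K \<Delta> d \<longleftrightarrow> simplicial_complex \<Delta> \<and> cdim \<Delta> = d \<and>
     (\<forall>F\<in>\<Delta>. sphere_homology K (link \<Delta> F) (d - int (card F)))"

inductive hball :: "'k::field itself \<Rightarrow> int \<Rightarrow> 'w::linorder set set \<Rightarrow> 'w set set \<Rightarrow> bool"
  for K :: "'k itself" where
  "\<lbrakk> simplicial_complex \<Gamma>; cdim \<Gamma> = d; acyclic K \<Gamma>;
     B \<subseteq> \<Gamma>; homology_sphere K B (d - 1);
     \<forall>F\<in>\<Gamma> - B. homology_sphere K (link \<Gamma> F) (d - int (card F));
     \<forall>F\<in>B. F \<noteq> {} \<longrightarrow> (\<exists>B'. hball K (d - int (card F)) (link \<Gamma> F) B') \<rbrakk>
   \<Longrightarrow> hball K d \<Gamma> B"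

definition restrict_tri :: "'w set set \<Rightarrow> ('w set \<Rightarrow> 'v set) \<Rightarrow> 'v set \<Rightarrow> 'w set set" where
  "restrict_tri \<Gamma> \<sigma> U = {F \<in> \<Gamma>. \<sigma> F \<subseteq> U}"

definition homology_triangulation ::
  "'k::field itself \<Rightarrow> 'w::linorder set set \<Rightarrow> ('w set \<Rightarrow> 'v set) \<Rightarrow> 'v set \<Rightarrow> bool" where
  "homology_triangulation K \<Gamma> \<sigma> V \<longleftrightarrow>
     finite V \<and> simplicial_complex \<Gamma> \<and> (\<forall>F\<in>\<Gamma>. \<sigma> F \<subseteq> V) \<and>
     (\<forall>U. U \<subseteq> V \<and> U \<noteq> {} \<longrightarrow>
        (\<exists>B. hball K (int (card U) - 1) (restrict_tri \<Gamma> \<sigma> U) B \<and>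
             restrict_tri \<Gamma> \<sigma> U - B = {F \<in> \<Gamma>. \<sigma> F = U}))"

definition quasi_geometric :: "'w set set \<Rightarrow> ('w set \<Rightarrow> 'v set) \<Rightarrow> 'v set \<Rightarrow> bool" where
  "quasi_geometric \<Gamma> \<sigma> V \<longleftrightarrow>
     \<not> (\<exists>F\<in>\<Gamma>. \<exists>U. U \<subseteq> V \<and> cdim (restrict_tri \<Gamma> \<sigma> U) < int (card F) - 1 \<and>
                     (\<forall>w\<in>F. \<sigma> {w} \<subseteq> U))"

text \<open>An element of the face ring k[\<Delta>] is represented by its coefficient function on
monomials (multisets of vertices); it has finite support and only monomials whose support
is a face of \<Delta> occur (the standard k-basis of k[\<Delta>]).\<close>

definition face_ring :: "'w set set \<Rightarrow> ('w multiset \<Rightarrow> 'k::field) set" where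
  "face_ring \<Delta> = {p. finite {m. p m \<noteq> 0} \<and> (\<forall>m. p m \<noteq> 0 \<longrightarrow> set_mset m \<in> \<Delta>)}"

definition fr_add :: "('w multiset \<Rightarrow> 'k::field) \<Rightarrow> ('w multiset \<Rightarrow> 'k) \<Rightarrow> 'w multiset \<Rightarrow> 'k" where
  "fr_add p q = (\<lambda>m. p m + q m)"

definition fr_mult :: "'w set set \<Rightarrow> ('w multiset \<Rightarrow> 'k::field) \<Rightarrow> ('w multiset \<Rightarrow> 'k) \<Rightarrow> 'w multiset \<Rightarrow> 'k" where
  "fr_mult \<Delta> p q = (\<lambda>m. if set_mset m \<in> \<Delta> then (\<Sum>a\<in>{a. a \<subseteq># m}. p a * q (m - a)) else 0)"

definition xmon :: "'w set \<Rightarrow> 'w multiset \<Rightarrow> 'k::field" where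
  "xmon F = (\<lambda>m. if m = mset_set F then 1 else 0)"

definition homog :: "nat \<Rightarrow> ('w multiset \<Rightarrow> 'k::field) \<Rightarrow> bool" where
  "homog j p \<longleftrightarrow> (\<forall>m. p m \<noteq> 0 \<longrightarrow> size m = j)"

definition ideal_gen :: "'w set set \<Rightarrow> ('w multiset \<Rightarrow> 'k::field) set \<Rightarrow> ('w multiset \<Rightarrow> 'k) set" where
  "ideal_gen \<Delta> S = {p. \<exists>(n::nat) (r :: nat \<Rightarrow> 'w multiset \<Rightarrow> 'k) s. (\<forall>j<n. r j \<in> face_ring \<Delta> \<and> s j \<in> S) \<and>
                              p = (\<lambda>m. \<Sum>j<n. fr_mult \<Delta> (r j) (s j) m)}"

definition cong_mod :: "('w multiset \<Rightarrow> 'k::field) set \<Rightarrow> ('w multiset \<Rightarrow> 'k) \<Rightarrow> ('w multiset \<Rightarrow> 'k) \<Rightarrow> bool" where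
  "cong_mod I p q \<longleftrightarrow> (\<lambda>m. p m - q m) \<in> I"

definition supp1 :: "('w multiset \<Rightarrow> 'k::field) \<Rightarrow> 'w set" where
  "supp1 p = {w. p {#w#} \<noteq> 0}"

definition restr :: "'w set set \<Rightarrow> ('w multiset \<Rightarrow> 'k::field) \<Rightarrow> 'w multiset \<Rightarrow> 'k" where
  "restr \<Delta>' p = (\<lambda>m. if set_mset m \<in> \<Delta>' then p m else 0)"

text \<open>\<theta> 0, ..., \<theta> (d-1) is an l.s.o.p. of k[\<Delta>] (d = Krull dimension, given explicitly):
d linear forms with finite-dimensional quotient.\<close>
definition lsop :: "'w set set \<Rightarrow> (nat \<Rightarrow> 'w multiset \<Rightarrow> 'k::field) \<Rightarrow> nat \<Rightarrow> bool" where
  "lsop \<Delta> \<theta> d \<longleftrightarrow> (\<forall>i<d. \<theta> i \<in> face_ring \<Delta> \<and> homog 1 (\<theta> i)) \<and>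
     (\<exists>S. finite S \<and> S \<subseteq> face_ring \<Delta> \<and>
        (\<forall>p\<in>face_ring \<Delta>. \<exists>c. cong_mod (ideal_gen \<Delta> (\<theta> ` {..<d})) p (\<lambda>m. \<Sum>s\<in>S. c s * s m)))"

definition special_lsop ::
  "'w set set \<Rightarrow> ('w set \<Rightarrow> 'v set) \<Rightarrow> 'v set \<Rightarrow> 'w set \<Rightarrow> (nat \<Rightarrow> 'w multiset \<Rightarrow> 'k::field) \<Rightarrow> bool" where
  "special_lsop \<Gamma> \<sigma> V E \<theta> \<longleftrightarrow> lsop (link \<Gamma> E) \<theta> (card V - card E) \<and>
     (\<exists>f. \<forall>v\<in>V - \<sigma> E. f v < card V - card E \<and>
          supp1 (\<theta> (f v)) \<subseteq> {w \<in> vertices (link \<Gamma> E). v \<in> \<sigma> {w}} \<and>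
          (\<forall>v'\<in>V - \<sigma> E. v \<noteq> v' \<longrightarrow> \<theta> (f v) \<noteq> \<theta> (f v')))"

text \<open>The ideal (x^F : F \<in> lk(E), F \<union> E interior) of k[lk(E)]; its image in the quotient
by the special l.s.o.p. is the local face module L(\<Gamma>,E).\<close>
definition int_ideal :: "'w set set \<Rightarrow> ('w set \<Rightarrow> 'v set) \<Rightarrow> 'v set \<Rightarrow> 'w set \<Rightarrow> ('w multiset \<Rightarrow> 'k::field) set" where
  "int_ideal \<Gamma> \<sigma> V E = ideal_gen (link \<Gamma> E) {xmon F | F. F \<in> link \<Gamma> E \<and> \<sigma> (F \<union> E) = V}"

definition Jideal :: "'w set set \<Rightarrow> 'w set \<Rightarrow> 'w set \<Rightarrow> (nat \<Rightarrow> 'w multiset \<Rightarrow> 'k::field) \<Rightarrow> nat \<Rightarrow> ('w multiset \<Rightarrow> 'k) set" where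
  "Jideal \<Gamma> E E' \<theta> d =
     (let St = cstar (link \<Gamma> E) (E' - E) in
      {p \<in> face_ring (link \<Gamma> E'). p \<in> ideal_gen St ((\<lambda>i. restr St (\<theta> i)) ` {..<d})})"

text \<open>\<phi> (acting on representatives) induces a homomorphism of graded k[lk(E')]-algebras
k[lk(E)]/(\<theta>) \<rightarrow> k[lk(E')]/J whose kernel contains the classes of x^F, F \<notin> Star(E' - E).\<close>
definition is_phi :: "'w set set \<Rightarrow> 'w set \<Rightarrow> 'w set \<Rightarrow> (nat \<Rightarrow> 'w multiset \<Rightarrow> 'k::field) \<Rightarrow> nat \<Rightarrow>
    (('w multiset \<Rightarrow> 'k) \<Rightarrow> ('w multiset \<Rightarrow> 'k)) \<Rightarrow> bool" where
  "is_phi \<Gamma> E E' \<theta> d \<phi> \<longleftrightarrow>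
     (let L = link \<Gamma> E; L' = link \<Gamma> E'; J = Jideal \<Gamma> E E' \<theta> d; I = ideal_gen L (\<theta> ` {..<d}) in
      (\<forall>p\<in>face_ring L. \<phi> p \<in> face_ring L') \<and>
      (\<forall>p\<in>face_ring L. \<forall>q\<in>face_ring L. cong_mod I p q \<longrightarrow> cong_mod J (\<phi> p) (\<phi> q)) \<and>
      (\<forall>p\<in>face_ring L. \<forall>q\<in>face_ring L. cong_mod J (\<phi> (fr_add p q)) (fr_add (\<phi> p) (\<phi> q))) \<and>
      (\<forall>p\<in>face_ring L. \<forall>q\<in>face_ring L.
          cong_mod J (\<phi> (fr_mult L p q)) (fr_mult L' (\<phi> p) (\<phi> q))) \<and>
      (\<forall>r\<in>face_ring L'. cong_mod J (\<phi> r) r) \<and>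
      (\<forall>p\<in>face_ring L. \<forall>j. homog j p \<longrightarrow> (\<exists>q\<in>face_ring L'. homog j q \<and> cong_mod J (\<phi> p) q)) \<and>
      (\<forall>F\<in>L. F \<notin> cstar L (E' - E) \<longrightarrow> cong_mod J (\<phi> (xmon F)) (\<lambda>_. 0)))"

end

theory Submission
  imports Defs "HOL-Library.Poly_Mapping" "HOL.Modules"
begin

text \<open>
  Put \<open>A = E' - E\<close>, a face of \<open>lk(E)\<close> with link \<open>lk(E')\<close>. Because \<open>k[lk(E)]/(\<theta>)\<close> is
  finite-dimensional, the coefficient matrix of \<open>\<theta>\<close> on \<open>A\<close> has trivial kernel, so some rows \<open>R\<close> of it
  form an invertible square matrix. These rows express every \<open>x\<^sub>a\<close>, \<open>a \<in> A\<close>, modulo \<open>\<theta>\<close> as a linear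
  form on \<open>lk(E')\<close>, and \<open>\<phi>\<close> is the resulting substitution: it sends \<open>\<theta>\<^sub>r\<close> to \<open>0\<close> for \<open>r \<in> R\<close>, and the
  images of the remaining \<open>\<theta>\<^sub>i\<close> are the \<open>\<zeta>\<^sub>i\<close>. If \<open>v \<notin> \<sigma>(E')\<close>, then the form \<open>\<theta>\<^sub>v\<close> vanishes on \<open>A\<close>, so its row
  is not in \<open>R\<close> and \<open>\<phi>\<close> merely restricts it to \<open>lk(E')\<close>. The \<open>\<zeta>\<^sub>i\<close> are distinct since \<open>lk(E')\<close> has a
  face with as many vertices as there are \<open>\<zeta>\<^sub>i\<close>.
\<close>

section \<open>Linear algebra\<close>

text \<open>The target of \<open>\<phi>\<close> is a quotient by a contraction, an ideal given
  without generators. Elimination supplies them because it is a retraction compatible with the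
  ideal: every polynomial is congruent to its substituted form modulo \<open>star_ideal\<close>,
  polynomials free of the variables in \<open>A\<close> are fixed, and \<open>star_ideal\<close>
  goes into the ideal generated by the forms \<open>phi (\<theta> i)\<close> and the nonfaces of the
  link. Hence those forms generate the contraction, and dropping the ones that vanish leaves d'
  generators. The same congruence forces uniqueness: \<open>f - phi f\<close> is a combination of
  the \<open>\<theta> i\<close> plus monomials off the star, and any competing homomorphism kills
  both. Multiplication in a face ring is truncated, so all this is done with honest polynomials
  modulo nonfaces. One obstacle remains: a nonface of the link may be a face of the star (each
  vertex of \<open>A\<close> is one). The inclusion needed holds only for polynomials free of
  \<open>A\<close>, which is why the class \<open>avoiding\<close> is carried along. The local face
  modules are respected because \<open>x^F\<close> becomes a multiple of \<open>x^(F - A)\<close>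
  and carriers are monotone.\<close>

lemma trivial_kernel_imp_inverse:
  fixes T :: "'i \<Rightarrow> 'a \<Rightarrow> 'k::field"
  assumes "finite A" and "finite I"
    and "\<And>u. (\<And>i. i \<in> I \<Longrightarrow> (\<Sum>a\<in>A. T i a * u a) = 0) \<Longrightarrow> (\<forall>a\<in>A. u a = 0)"
  shows "\<exists>R M. R \<subseteq> I \<and> card R = card A \<and>
    (\<forall>a\<in>A. \<forall>b\<in>A. (\<Sum>r\<in>R. M a r * T r b) = (if a = b then 1 else 0)) \<and>
    (\<forall>r\<in>R. \<forall>r'\<in>R. (\<Sum>a\<in>A. T r a * M a r') = (if r = r' then 1 else 0))"
  using assms(1,3)
\<comment> \<open>Bordering: an invertible block for \<open>A\<close> is enlarged by the column
  \<open>a\<close> and one new row, and its inverse by a rank-one correction.\<close>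
proof (induction A rule: finite_induct)
  case empty
  show ?case by (rule exI[of _ "{}"]) auto
next
  case (insert a A)
  have triv: "\<forall>b\<in>A. u b = 0" if u: "\<And>i. i \<in> I \<Longrightarrow> (\<Sum>b\<in>A. T i b * u b) = 0" for u
  proof -
    have "(\<Sum>b\<in>insert a A. T i b * (u(a := 0)) b) = 0" if "i \<in> I" for i
    proof -
      have "(\<Sum>b\<in>A. T i b * (u(a := 0)) b) = (\<Sum>b\<in>A. T i b * u b)"
        using insert.hyps by (intro sum.cong) auto
      then show ?thesis using insert.hyps u[OF that] by simp
    qed
    from insert.prems[OF this] show ?thesis using insert.hyps by (metis fun_upd_other insertCI)
  qed
  from insert.IH[OF triv] obtain R M where R: "R \<subseteq> I" "card R = card A"
    and left: "\<forall>x\<in>A. \<forall>y\<in>A. (\<Sum>r\<in>R. M x r * T r y) = (if x = y then 1 else 0)"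
    and right: "\<forall>r\<in>R. \<forall>r'\<in>R. (\<Sum>x\<in>A. T r x * M x r') = (if r = r' then 1 else 0)"
    by blast
  have finR: "finite R" using R(1) assms(2) finite_subset by blast
  \<comment> \<open>The candidate kernel vector with entry 1 at \<open>a\<close>; its other entries
    are forced by the rows in \<open>R\<close>. Then \<open>e i\<close> is the Schur complement of
    the block for row \<open>i\<close>.\<close>
  define u where "u b = (if b = a then 1 else - (\<Sum>r\<in>R. M b r * T r a))" for b
  define e where "e i = (\<Sum>x\<in>insert a A. T i x * u x)" for i
  have e_eq: "e i = T i a + (\<Sum>x\<in>A. T i x * u x)" for i
    unfolding e_def using insert.hyps by (simp add: u_def)
  have uA: "u b = - (\<Sum>r\<in>R. M b r * T r a)" if "b \<in> A" for b
    using that insert.hyps by (auto simp: u_def)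
  have e_eq': "e i = T i a - (\<Sum>r\<in>R. (\<Sum>x\<in>A. T i x * M x r) * T r a)" for i
  proof -
    have "(\<Sum>x\<in>A. T i x * u x) = - (\<Sum>x\<in>A. \<Sum>r\<in>R. T i x * M x r * T r a)"
      by (simp add: uA sum_distrib_left sum_negf mult.assoc)
    also have "(\<Sum>x\<in>A. \<Sum>r\<in>R. T i x * M x r * T r a) = (\<Sum>r\<in>R. (\<Sum>x\<in>A. T i x * M x r) * T r a)"
      by (subst sum.swap) (simp add: sum_distrib_right)
    finally show ?thesis by (simp add: e_eq)
  qed
  have eR: "e r = 0" if "r \<in> R" for r
  proof -
    have "(\<Sum>r'\<in>R. (\<Sum>x\<in>A. T r x * M x r') * T r' a) = (\<Sum>r'\<in>R. if r = r' then T r' a else 0)"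
      using right that by (intro sum.cong) auto
    also have "\<dots> = T r a" using that finR by simp
    finally show ?thesis by (simp add: e_eq')
  qed
  \<comment> \<open>Since \<open>u\<close> is nonzero, the trivial kernel leaves a row on which it
    does not vanish; that row is the pivot.\<close>
  obtain i where i: "i \<in> I" "e i \<noteq> 0"
  proof -
    have "\<not> (\<forall>b\<in>insert a A. u b = 0)" by (auto simp: u_def)
    then show ?thesis using insert.prems[of u] that unfolding e_def by blast
  qed
  have iR: "i \<notin> R" using eR i by blast
  \<comment> \<open>\<open>m\<close> is the row of the new inverse belonging to \<open>a\<close>.
    The whole inverse \<open>N\<close> is \<open>M\<close>, padded by 0, plus the outer product of
    \<open>u\<close> and \<open>m\<close>.\<close>
  define m where "m r = (if r = i then 1 / e i else - (\<Sum>x\<in>A. T i x * M x r) / e i)" for r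
  define N where "N b r = (if b = a then m r else (if r = i then 0 else M b r) + u b * m r)" for b r
  have m_left: "(\<Sum>r\<in>insert i R. m r * T r x) = (if x = a then 1 else 0)" if x: "x \<in> insert a A" for x
  proof -
    have "(\<Sum>r\<in>R. m r * T r x) = (\<Sum>r\<in>R. - ((\<Sum>y\<in>A. T i y * M y r) * T r x) / e i)"
      using iR by (intro sum.cong) (auto simp: m_def)
    also have "\<dots> = - (\<Sum>r\<in>R. (\<Sum>y\<in>A. T i y * M y r) * T r x) / e i"
      by (simp add: sum_negf sum_divide_distrib)
    finally have *: "(\<Sum>r\<in>insert i R. m r * T r x)
        = (T i x - (\<Sum>r\<in>R. (\<Sum>y\<in>A. T i y * M y r) * T r x)) / e i"
      using finR iR by (simp add: m_def diff_divide_distrib)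
    show ?thesis
    proof (cases "x = a")
      case True
      then show ?thesis using * i e_eq' by simp
    next
      case False
      then have xA: "x \<in> A" using x by simp
      have "(\<Sum>r\<in>R. (\<Sum>y\<in>A. T i y * M y r) * T r x) = (\<Sum>y\<in>A. T i y * (\<Sum>r\<in>R. M y r * T r x))"
        by (simp add: sum_distrib_left sum_distrib_right mult.assoc) (rule sum.swap)
      also have "\<dots> = (\<Sum>y\<in>A. if y = x then T i y else 0)"
        using left xA by (intro sum.cong) auto
      also have "\<dots> = T i x" using xA insert.hyps by simp
      finally show ?thesis using * False by simp
    qed
  qed
  have "(\<Sum>r\<in>insert i R. N x r * T r y) = (if x = y then 1 else 0)"
    if x: "x \<in> insert a A" and y: "y \<in> insert a A" for x y
  proof (cases "x = a")
    case True
    then show ?thesis using m_left[OF y] by (auto simp: N_def)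
  next
    case False
    then have xA: "x \<in> A" using x by simp
    have "(\<Sum>r\<in>insert i R. N x r * T r y)
      = (\<Sum>r\<in>insert i R. (if r = i then 0 else M x r * T r y) + u x * (m r * T r y))"
      using False by (intro sum.cong) (auto simp: N_def algebra_simps)
    also have "\<dots> = (\<Sum>r\<in>insert i R. if r = i then 0 else M x r * T r y)
         + u x * (\<Sum>r\<in>insert i R. m r * T r y)"
      by (simp only: sum.distrib sum_distrib_left)
    also have "(\<Sum>r\<in>insert i R. if r = i then 0 else M x r * T r y) = (\<Sum>r\<in>R. M x r * T r y)"
      using finR iR by (simp, intro sum.cong) auto
    finally have *: "(\<Sum>r\<in>insert i R. N x r * T r y)
      = (\<Sum>r\<in>R. M x r * T r y) + u x * (if y = a then 1 else 0)"
      using m_left[OF y] by simp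
    show ?thesis
    proof (cases "y = a")
      case True
      then show ?thesis using * False by (simp add: uA[OF xA])
    next
      case False
      then show ?thesis using * left xA y by auto
    qed
  qed
  \<comment> \<open>Here the outer product contributes \<open>e r * m r'\<close>, which vanishes on
    the old rows because \<open>e\<close> does.\<close>
  moreover have "(\<Sum>x\<in>insert a A. T r x * N x r') = (if r = r' then 1 else 0)"
    if r: "r \<in> insert i R" and r': "r' \<in> insert i R" for r r'
  proof -
    have "(\<Sum>x\<in>A. T r x * N x r')
       = (\<Sum>x\<in>A. (if r' = i then 0 else T r x * M x r') + (T r x * u x) * m r')"
      using insert.hyps by (intro sum.cong) (auto simp: N_def algebra_simps)
    also have "\<dots> = (if r' = i then 0 else (\<Sum>x\<in>A. T r x * M x r')) + (\<Sum>x\<in>A. T r x * u x) * m r'"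
      by (simp add: sum.distrib sum_distrib_right)
    finally have *: "(\<Sum>x\<in>insert a A. T r x * N x r')
       = (if r' = i then 0 else (\<Sum>x\<in>A. T r x * M x r')) + e r * m r'"
      using insert.hyps by (simp add: e_eq N_def algebra_simps)
    show ?thesis
    proof (cases "r = i")
      case True
      then show ?thesis using * i by (auto simp: m_def)
    next
      case False
      then have rR: "r \<in> R" using r by simp
      then show ?thesis using * r' right eR[OF rR] False by auto
    qed
  qed
  moreover have "insert i R \<subseteq> I" "card (insert i R) = card (insert a A)"
    using R i iR finR insert.hyps by auto
  ultimately show ?case by blast
qed

section \<open>Polynomials and substitution\<close>

abbreviation lookup :: "('a \<Rightarrow>\<^sub>0 'b::zero) \<Rightarrow> 'a \<Rightarrow> 'b" where
  "lookup \<equiv> Poly_Mapping.lookup"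

abbreviation single :: "'a \<Rightarrow> 'b \<Rightarrow> ('a \<Rightarrow>\<^sub>0 'b::zero)" where
  "single \<equiv> Poly_Mapping.single"

text \<open>A ring is a module over itself and its submodules are its ideals, so
  \<open>ideal.span\<close> is the generated ideal.\<close>

interpretation ideal: module "(*) :: 'a \<Rightarrow> 'a::comm_ring_1 \<Rightarrow> 'a"
  by standard (simp_all add: algebra_simps)

lemma finite_submultisets: "finite {a. a \<subseteq># (m :: 'a multiset)}"
proof (induction m)
  case empty
  then show ?case by simp
next
  case (add x m)
  have "{a. a \<subseteq># add_mset x m} \<subseteq> {a. a \<subseteq># m} \<union> add_mset x ` {a. a \<subseteq># m}"
  proof
    fix a assume a: "a \<in> {a. a \<subseteq># add_mset x m}"
    show "a \<in> {a. a \<subseteq># m} \<union> add_mset x ` {a. a \<subseteq># m}"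
    proof (cases "x \<in># a")
      case True
      then obtain b where "a = add_mset x b" by (metis multi_member_split)
      then show ?thesis using a by auto
    next
      case False
      then have "count a x = 0" by (simp add: not_in_iff)
      have "a \<subseteq># m"
      proof (rule mset_subset_eqI)
        fix y
        show "count a y \<le> count m y"
          using mset_subset_eq_count[of a "add_mset x m" y] a \<open>count a x = 0\<close> by (cases "y = x") auto
      qed
      then show ?thesis by blast
    qed
  qed
  then show ?case using add by (meson finite_Un finite_imageI finite_subset)
qed

text \<open>Convolution over all pairs collapses to the divisors of \<open>m\<close>, the form in
  which \<open>fr_mult\<close> is defined.\<close>

lemma lookup_mult_multiset:
  fixes p q :: "'w multiset \<Rightarrow>\<^sub>0 'k::comm_ring_1"
  shows "lookup (p * q) m = (\<Sum>a\<in>{a. a \<subseteq># m}. lookup p a * lookup q (m - a))"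
proof -
  have inner: "(\<Sum>b. lookup q b when m = a + b) = (lookup q (m - a) when a \<subseteq># m)" for a
  proof (cases "a \<subseteq># m")
    case True
    then obtain c where c: "m = a + c" by (auto simp: subset_mset.le_iff_add)
    have "(\<Sum>b. lookup q b when c = b) = lookup q c" by (rule Sum_any_when_equal')
    then show ?thesis by (simp add: c)
  next
    case False
    then have "(\<lambda>b. lookup q b when m = a + b) = (\<lambda>b. 0)"
      by (auto simp: fun_eq_iff when_def)
    from arg_cong[OF this, of Sum_any] show ?thesis using False by simp
  qed
  have "lookup (p * q) m = (\<Sum>a. lookup p a * (lookup q (m - a) when a \<subseteq># m))"
    unfolding lookup_mult inner ..
  also have "\<dots> = (\<Sum>a\<in>{a. a \<subseteq># m}. lookup p a * (lookup q (m - a) when a \<subseteq># m))"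
    by (rule Sum_any.expand_superset[OF finite_submultisets]) (auto simp: when_def)
  also have "\<dots> = (\<Sum>a\<in>{a. a \<subseteq># m}. lookup p a * lookup q (m - a))"
    by (intro sum.cong refl) (simp only: when_def mem_Collect_eq if_True)
  finally show ?thesis .
qed

lemma sum_single_lookup:
  fixes p :: "'a \<Rightarrow>\<^sub>0 'b::comm_monoid_add"
  shows "(\<Sum>m\<in>Poly_Mapping.keys p. single m (lookup p m)) = p"
proof (rule poly_mapping_eqI)
  fix k
  have "lookup (\<Sum>m\<in>Poly_Mapping.keys p. single m (lookup p m)) k
    = (\<Sum>m\<in>Poly_Mapping.keys p. if m = k then lookup p m else 0)"
    by (auto simp: lookup_sum lookup_single when_def intro!: sum.cong)
  also have "\<dots> = lookup p k" by (simp add: in_keys_iff)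
  finally show "lookup (\<Sum>m\<in>Poly_Mapping.keys p. single m (lookup p m)) k = lookup p k" .
qed

text \<open>The monomial case may assume that \<open>m\<close> occurs in the original
  \<open>p\<close>; this allows induction inside a class of polynomials described by its monomials,
  such as \<open>nonfaces\<close>.\<close>

lemma poly_mapping_sum_induct [case_names zero single add]:
  fixes p :: "'a \<Rightarrow>\<^sub>0 'b::comm_monoid_add"
  assumes "P 0" and "\<And>m c. c \<noteq> 0 \<Longrightarrow> m \<in> Poly_Mapping.keys p \<Longrightarrow> P (single m c)"
    and "\<And>p q. P p \<Longrightarrow> P q \<Longrightarrow> P (p + q)"
  shows "P p"
proof -
  have "P (\<Sum>m\<in>K. single m (lookup p m))" if "finite K" "K \<subseteq> Poly_Mapping.keys p" for K
    using that by (induction K rule: finite_induct) (use assms in \<open>auto simp: in_keys_iff\<close>)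
  from this[of "Poly_Mapping.keys p"] show ?thesis by (simp add: sum_single_lookup)
qed

definition subst :: "('w \<Rightarrow> ('v multiset \<Rightarrow>\<^sub>0 'k)) \<Rightarrow> ('w multiset \<Rightarrow>\<^sub>0 'k) \<Rightarrow> ('v multiset \<Rightarrow>\<^sub>0 'k::comm_ring_1)" where
  "subst g p = (\<Sum>m\<in>Poly_Mapping.keys p. single 0 (lookup p m) * (\<Prod>w\<in>#m. g w))"

lemma subst_superset:
  assumes "finite K" and "Poly_Mapping.keys p \<subseteq> K"
  shows "subst g p = (\<Sum>m\<in>K. single 0 (lookup p m) * (\<Prod>w\<in>#m. g w))"
  unfolding subst_def by (rule sum.mono_neutral_left) (use assms in \<open>auto simp: in_keys_iff\<close>)

lemma subst_zero [simp]: "subst g 0 = 0"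
  by (simp add: subst_def)

lemma subst_single [simp]: "subst g (single m c) = single 0 c * (\<Prod>w\<in>#m. g w)"
  by (subst subst_superset[of "{m}"]) auto

lemma subst_add: "subst g (p + q) = subst g p + subst g q"
proof -
  let ?K = "Poly_Mapping.keys p \<union> Poly_Mapping.keys q"
  have "subst g (p + q) = (\<Sum>m\<in>?K. single 0 (lookup (p + q) m) * (\<Prod>w\<in>#m. g w))"
    by (rule subst_superset) (auto simp: keys_add)
  moreover have "subst g p = (\<Sum>m\<in>?K. single 0 (lookup p m) * (\<Prod>w\<in>#m. g w))"
    and "subst g q = (\<Sum>m\<in>?K. single 0 (lookup q m) * (\<Prod>w\<in>#m. g w))"
    by (rule subst_superset; auto)+
  ultimately show ?thesis
    by (simp add: lookup_add single_add distrib_right sum.distrib)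
qed

lemma subst_mult:
  fixes g :: "'w \<Rightarrow> ('v multiset \<Rightarrow>\<^sub>0 'k::comm_ring_1)"
  shows "subst g (p * q) = subst g p * subst g q"
proof (induction p rule: poly_mapping_sum_induct)
  case zero
  show ?case by simp
next
  case (single m c)
  show ?case
  proof (induction q rule: poly_mapping_sum_induct)
    case zero
    show ?case by simp
  next
    case (single m' c')
    have "subst g (single m c * single m' c') = single 0 (c * c') * ((\<Prod>w\<in>#m. g w) * (\<Prod>w\<in>#m'. g w))"
      by (simp add: mult_single)
    also have "single 0 (c * c') = single 0 c * single (0 :: 'v multiset) c'" by (simp add: mult_single)
    finally show ?case unfolding subst_single by (simp only: mult_ac)
  next
    case (add p q)
    then show ?case by (simp add: distrib_left subst_add)
  qed
next
  case (add p q)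
  then show ?case by (simp add: distrib_right subst_add)
qed

lemma subst_uminus: "subst g (- p) = - subst g p"
  using subst_add[of g p "- p"] by (simp add: add_eq_0_iff)

lemma subst_diff: "subst g (p - q) = subst g p - subst g q"
  using subst_add[of g p "- q"] by (simp add: subst_uminus)

lemma subst_sum: "subst g (sum f I) = (\<Sum>i\<in>I. subst g (f i))"
  by (induction I rule: infinite_finite_induct) (auto simp: subst_add)

lemma prod_mset_variables: "(\<Prod>w\<in>#m. single {#w#} 1) = (single m 1 :: 'w multiset \<Rightarrow>\<^sub>0 'k::comm_ring_1)"
  by (induction m) (simp_all add: mult_single)

lemma subst_mem_closed:
  assumes "\<And>c. single 0 c \<in> C" and "\<And>p q. p \<in> C \<Longrightarrow> q \<in> C \<Longrightarrow> p + q \<in> C"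
    and "\<And>p q. p \<in> C \<Longrightarrow> q \<in> C \<Longrightarrow> p * q \<in> C" and "\<And>w. g w \<in> C"
  shows "subst g p \<in> C"
proof (induction p rule: poly_mapping_sum_induct)
  case zero
  show ?case using assms(1)[of 0] by simp
next
  case (single m c)
  have "(\<Prod>w\<in>#m. g w) \<in> C"
    by (induction m) (use assms assms(1)[of 1] in auto)
  then show ?case using assms by simp
next
  case (add p q)
  then show ?case using assms by (simp add: subst_add)
qed

text \<open>Two algebra maps that agree on the variables modulo an ideal agree on every polynomial;
  the second map here is the identity.\<close>

lemma diff_subst_mem_ideal:
  fixes p :: "'w multiset \<Rightarrow>\<^sub>0 'k::comm_ring_1"
  assumes "\<And>w. single {#w#} 1 - g w \<in> ideal.span I"
  shows "p - subst g p \<in> ideal.span I"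
proof (induction p rule: poly_mapping_sum_induct)
  case zero
  show ?case unfolding subst_zero diff_0_right by (rule ideal.span_zero)
next
  case (single m c)
  have "single m 1 - (\<Prod>w\<in>#m. g w) \<in> ideal.span I"
  proof (induction m)
    case empty
    have "single {#} 1 - (\<Prod>w\<in>#{#}. g w) = 0" by simp
    then show ?case by (simp only: ideal.span_zero)
  next
    case (add w m)
    have X: "single (add_mset w m) 1 = single {#w#} 1 * (single m 1 :: 'w multiset \<Rightarrow>\<^sub>0 'k)"
      by (simp add: mult_single)
    \<comment> \<open>Telescoping: the factors are exchanged one variable at a time.\<close>
    have eq: "single (add_mset w m) 1 - (\<Prod>w\<in>#add_mset w m. g w)
       = single m 1 * (single {#w#} 1 - g w) + g w * (single m 1 - (\<Prod>w\<in>#m. g w))"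
      unfolding X by (simp only: image_mset_add_mset prod_mset.add_mset) (simp only: algebra_simps)
    show ?case unfolding eq by (intro ideal.span_add ideal.span_scale assms add)
  qed
  then have "single 0 c * (single m 1 - (\<Prod>w\<in>#m. g w)) \<in> ideal.span I"
    by (rule ideal.span_scale)
  then show ?case by (simp add: right_diff_distrib mult_single)
next
  case (add p q)
  have eq: "p + q - subst g (p + q) = (p - subst g p) + (q - subst g q)" by (simp add: subst_add)
  show ?case unfolding eq using add by (rule ideal.span_add)
qed

lemma subst_mem_ideal:
  assumes "p \<in> ideal.span I" and "\<And>q. q \<in> I \<Longrightarrow> subst g q \<in> ideal.span I'"
  shows "subst g p \<in> ideal.span I'"
  using assms(1)
proof (induction p rule: ideal.span_induct_alt)
  case base
  show ?case unfolding subst_zero by (rule ideal.span_zero)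
next
  case (step c x y)
  have "subst g c * subst g x + subst g y \<in> ideal.span I'"
    by (intro ideal.span_add ideal.span_scale assms(2) step)
  then show ?case by (simp only: subst_add subst_mult)
qed

section \<open>Face rings as quotients of polynomial rings\<close>

lemma simplicial_complex_subset: "simplicial_complex \<Delta> \<Longrightarrow> F \<in> \<Delta> \<Longrightarrow> G \<subseteq> F \<Longrightarrow> G \<in> \<Delta>"
  by (auto simp: simplicial_complex_def)

lemma simplicial_complex_finite_face:
  assumes "simplicial_complex \<Delta>" and "F \<in> \<Delta>"
  shows "finite F"
proof -
  have "Pow F \<subseteq> \<Delta>" and "finite \<Delta>" using assms by (auto simp: simplicial_complex_def)
  then have "finite (Pow F)" by (rule finite_subset)
  then show ?thesis by simp
qed

lemma finite_vertices:
  assumes "simplicial_complex \<Delta>"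
  shows "finite (vertices \<Delta>)"
proof -
  have "(\<lambda>w. {w}) ` vertices \<Delta> \<subseteq> \<Delta>" and "finite \<Delta>"
    using assms by (auto simp: vertices_def simplicial_complex_def)
  then have "finite ((\<lambda>w. {w}) ` vertices \<Delta>)" by (rule finite_subset)
  then show ?thesis by (rule finite_imageD) simp
qed

lemma face_subset_vertices: "simplicial_complex \<Delta> \<Longrightarrow> F \<in> \<Delta> \<Longrightarrow> F \<subseteq> vertices \<Delta>"
  using simplicial_complex_subset by (fastforce simp: vertices_def)

lemma face_ring_zero: "(\<lambda>_. 0) \<in> face_ring \<Delta>"
  by (simp add: face_ring_def)

lemma face_ring_sum:
  assumes "\<And>i. i \<in> I \<Longrightarrow> f i \<in> face_ring \<Delta>"
  shows "(\<lambda>m. \<Sum>i\<in>I. c i * f i m) \<in> face_ring \<Delta>"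
proof (cases "finite I")
  case True
  have sub: "{m. (\<Sum>i\<in>I. c i * f i m) \<noteq> 0} \<subseteq> (\<Union>i\<in>I. {m. f i m \<noteq> 0})"
    by (auto intro: ccontr)
  then have "finite {m. (\<Sum>i\<in>I. c i * f i m) \<noteq> 0}"
    by (rule finite_subset) (use True assms in \<open>auto simp: face_ring_def\<close>)
  then show ?thesis using sub assms by (auto simp: face_ring_def)
next
  case False
  then show ?thesis by (simp add: face_ring_zero)
qed

lemma face_ring_add:
  assumes "f \<in> face_ring \<Delta>" and "g \<in> face_ring \<Delta>"
  shows "(\<lambda>m. f m + g m) \<in> face_ring \<Delta>"
proof -
  have sub: "{m. f m + g m \<noteq> 0} \<subseteq> {m. f m \<noteq> 0} \<union> {m. g m \<noteq> 0}" by auto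
  then have "finite {m. f m + g m \<noteq> 0}"
    by (rule finite_subset) (use assms in \<open>auto simp: face_ring_def\<close>)
  then show ?thesis using sub assms by (auto simp: face_ring_def)
qed

lemma face_ring_mono: "\<Delta>' \<subseteq> \<Delta> \<Longrightarrow> face_ring \<Delta>' \<subseteq> face_ring \<Delta>"
  by (auto simp: face_ring_def)

lemma xmon_mem_face_ring: "finite F \<Longrightarrow> F \<in> \<Delta> \<Longrightarrow> xmon F \<in> face_ring \<Delta>"
  by (auto simp: xmon_def face_ring_def)

text \<open>A face ring is the quotient of the polynomial ring by \<open>nonfaces\<close>, with
  \<open>to_poly\<close> the canonical linear section of the projection \<open>to_face_ring\<close>.\<close>

definition nonfaces :: "'w set set \<Rightarrow> ('w multiset \<Rightarrow>\<^sub>0 'k::field) set" where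
  "nonfaces \<Delta> = {p. \<forall>m. lookup p m \<noteq> 0 \<longrightarrow> set_mset m \<notin> \<Delta>}"

definition to_poly :: "('w multiset \<Rightarrow> 'k::field) \<Rightarrow> 'w multiset \<Rightarrow>\<^sub>0 'k" where
  "to_poly f = Abs_poly_mapping f"

definition to_face_ring :: "'w set set \<Rightarrow> ('w multiset \<Rightarrow>\<^sub>0 'k::field) \<Rightarrow> 'w multiset \<Rightarrow> 'k" where
  "to_face_ring \<Delta> p = restr \<Delta> (lookup p)"

lemma lookup_to_poly: "f \<in> face_ring \<Delta> \<Longrightarrow> lookup (to_poly f) = f"
  by (simp add: to_poly_def face_ring_def)

text \<open>Membership guarantees finite support; outside such functions
  \<open>Abs_poly_mapping\<close> is unspecified.\<close>

lemma to_poly_add: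
  assumes "f \<in> face_ring \<Delta>" and "g \<in> face_ring \<Delta>"
  shows "to_poly (\<lambda>m. f m + g m) = to_poly f + to_poly g"
  using lookup_to_poly[OF face_ring_add[OF assms]] lookup_to_poly[OF assms(1)] lookup_to_poly[OF assms(2)]
  by (intro poly_mapping_eqI) (simp add: lookup_add)

lemma to_poly_sum:
  assumes "\<And>i. i \<in> I \<Longrightarrow> f i \<in> face_ring \<Delta>"
  shows "to_poly (\<lambda>m. \<Sum>i\<in>I. c i * f i m) = (\<Sum>i\<in>I. single 0 (c i) * to_poly (f i))"
proof (rule poly_mapping_eqI)
  fix m
  have "lookup (single 0 (c i) * to_poly (f i)) m = c i * f i m" if "i \<in> I" for i
    using lookup_to_poly[OF assms[OF that]]
    by (simp flip: mult_map_scale_conv_mult add: Poly_Mapping.map.rep_eq when_def)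
  then show "lookup (to_poly (\<lambda>m. \<Sum>i\<in>I. c i * f i m)) m = lookup (\<Sum>i\<in>I. single 0 (c i) * to_poly (f i)) m"
    by (simp add: lookup_sum lookup_to_poly[OF face_ring_sum[of I f \<Delta> c, OF assms]])
qed

lemma to_face_ring_mem: "to_face_ring \<Delta> p \<in> face_ring \<Delta>"
proof -
  have "{m. to_face_ring \<Delta> p m \<noteq> 0} \<subseteq> Poly_Mapping.keys p"
    by (auto simp: to_face_ring_def restr_def in_keys_iff)
  then have "finite {m. to_face_ring \<Delta> p m \<noteq> 0}" by (rule finite_subset) simp
  then show ?thesis by (auto simp: face_ring_def to_face_ring_def restr_def)
qed

lemma to_face_ring_to_poly: "f \<in> face_ring \<Delta> \<Longrightarrow> to_face_ring \<Delta> (to_poly f) = f"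
  by (auto simp: to_face_ring_def lookup_to_poly restr_def face_ring_def fun_eq_iff)

lemma lookup_to_poly_to_face_ring: "lookup (to_poly (to_face_ring \<Delta> p)) = restr \<Delta> (lookup p)"
  using lookup_to_poly[OF to_face_ring_mem] by (simp add: to_face_ring_def)

lemma to_poly_to_face_ring_diff: "to_poly (to_face_ring \<Delta> p) - p \<in> nonfaces \<Delta>"
  by (auto simp: nonfaces_def lookup_minus lookup_to_poly_to_face_ring restr_def)

lemma to_face_ring_add: "to_face_ring \<Delta> (p + q) = (\<lambda>m. to_face_ring \<Delta> p m + to_face_ring \<Delta> q m)"
  by (auto simp: to_face_ring_def restr_def lookup_add)

lemma to_face_ring_eq_zero_iff: "to_face_ring \<Delta> p = (\<lambda>_. 0) \<longleftrightarrow> p \<in> nonfaces \<Delta>"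
  by (auto simp: to_face_ring_def restr_def nonfaces_def fun_eq_iff)

lemma to_face_ring_cong: "p - q \<in> nonfaces \<Delta> \<Longrightarrow> to_face_ring \<Delta> p = to_face_ring \<Delta> q"
  by (auto simp: to_face_ring_def restr_def nonfaces_def fun_eq_iff lookup_minus)

text \<open>Divisors of a monomial supported on a face are again supported on faces, so truncating
  the factors loses no term of the truncated product.\<close>

lemma to_face_ring_mult:
  assumes "simplicial_complex \<Delta>"
  shows "to_face_ring \<Delta> (p * q) = fr_mult \<Delta> (to_face_ring \<Delta> p) (to_face_ring \<Delta> q)"
proof
  fix m
  show "to_face_ring \<Delta> (p * q) m = fr_mult \<Delta> (to_face_ring \<Delta> p) (to_face_ring \<Delta> q) m"
  proof (cases "set_mset m \<in> \<Delta>")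
    case True
    have "set_mset a \<in> \<Delta>" and "set_mset (m - a) \<in> \<Delta>" if "a \<subseteq># m" for a
      using True that simplicial_complex_subset[OF assms True]
      by (meson set_mset_mono diff_subset_eq_self)+
    then show ?thesis using True
      by (auto simp: to_face_ring_def restr_def fr_mult_def lookup_mult_multiset intro!: sum.cong)
  next
    case False
    then show ?thesis by (simp add: to_face_ring_def restr_def fr_mult_def)
  qed
qed

lemma fr_mult_eq_to_face_ring:
  assumes "simplicial_complex \<Delta>" and "f \<in> face_ring \<Delta>" and "g \<in> face_ring \<Delta>"
  shows "fr_mult \<Delta> f g = to_face_ring \<Delta> (to_poly f * to_poly g)"
  using assms by (simp add: to_face_ring_mult to_face_ring_to_poly)

lemma nonfaces_add: "p \<in> nonfaces \<Delta> \<Longrightarrow> q \<in> nonfaces \<Delta> \<Longrightarrow> p + q \<in> nonfaces \<Delta>"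
  by (auto simp: nonfaces_def lookup_add) (metis add.right_neutral)

text \<open>\<open>nonfaces\<close> is the kernel of the multiplicative map
  \<open>to_face_ring\<close>, hence it absorbs products.\<close>

lemma nonfaces_mult:
  assumes "simplicial_complex \<Delta>" and "q \<in> nonfaces \<Delta>"
  shows "p * q \<in> nonfaces \<Delta>"
proof -
  have "to_face_ring \<Delta> q = (\<lambda>_. 0)" using assms(2) by (simp add: to_face_ring_eq_zero_iff)
  then have "to_face_ring \<Delta> (p * q) = (\<lambda>_. 0)"
    unfolding to_face_ring_mult[OF assms(1)] by (simp add: fr_mult_def fun_eq_iff)
  then show ?thesis by (simp only: to_face_ring_eq_zero_iff)
qed

lemma nonfaces_antimono: "\<Delta>' \<subseteq> \<Delta> \<Longrightarrow> nonfaces \<Delta> \<subseteq> nonfaces \<Delta>'"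
  by (auto simp: nonfaces_def)

text \<open>Correspondence of ideals in a quotient: a face-ring ideal pulls back to the ideal
  generated by lifts of its generators and the kernel \<open>nonfaces\<close>. From here on,
  membership is decided in the polynomial ring.\<close>

lemma to_face_ring_mem_ideal_gen_iff:
  fixes p :: "'w multiset \<Rightarrow>\<^sub>0 'k::field"
  assumes \<Delta>: "simplicial_complex \<Delta>" and S: "S \<subseteq> face_ring \<Delta>"
  shows "to_face_ring \<Delta> p \<in> ideal_gen \<Delta> S \<longleftrightarrow> p \<in> ideal.span (to_poly ` S \<union> nonfaces \<Delta>)"
    (is "_ \<longleftrightarrow> _ \<in> ideal.span ?I")
proof
  assume "to_face_ring \<Delta> p \<in> ideal_gen \<Delta> S"
  then obtain n and r s :: "nat \<Rightarrow> 'w multiset \<Rightarrow> 'k" where rs: "\<And>j. j < n \<Longrightarrow> r j \<in> face_ring \<Delta> \<and> s j \<in> S"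
    and p: "to_face_ring \<Delta> p = (\<lambda>m. \<Sum>j<n. fr_mult \<Delta> (r j) (s j) m)"
    unfolding ideal_gen_def by blast
  have eq: "fr_mult \<Delta> (r j) (s j) = to_face_ring \<Delta> (to_poly (r j) * to_poly (s j))" if "j < n" for j
    using fr_mult_eq_to_face_ring[OF \<Delta>] rs[OF that] S by blast
  have base: "q \<in> ideal.span ?I" if "q \<in> nonfaces \<Delta>" for q
    using that by (auto intro: ideal.span_base)
  have "to_poly (\<lambda>m. \<Sum>j<n. fr_mult \<Delta> (r j) (s j) m) = (\<Sum>j<n. to_poly (fr_mult \<Delta> (r j) (s j)))"
    using to_poly_sum[of "{..<n}" "\<lambda>j. fr_mult \<Delta> (r j) (s j)" \<Delta> "\<lambda>_. 1"] eq to_face_ring_mem by auto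
  moreover have "to_poly (fr_mult \<Delta> (r j) (s j)) \<in> ideal.span ?I" if "j < n" for j
  proof -
    have "to_poly (s j) \<in> ideal.span ?I" using rs[OF that] by (auto intro: ideal.span_base)
    then have "to_poly (r j) * to_poly (s j) \<in> ideal.span ?I" by (rule ideal.span_scale)
    \<comment> \<open>The truncated product differs from the polynomial product by nonfaces
      only.\<close>
    moreover have "to_poly (fr_mult \<Delta> (r j) (s j)) - to_poly (r j) * to_poly (s j) \<in> ideal.span ?I"
      unfolding eq[OF that] by (rule base[OF to_poly_to_face_ring_diff])
    ultimately show ?thesis using ideal.span_add by fastforce
  qed
  ultimately have "to_poly (to_face_ring \<Delta> p) \<in> ideal.span ?I"
    unfolding p by (metis (no_types, lifting) ideal.span_sum lessThan_iff)
  moreover have "to_poly (to_face_ring \<Delta> p) - p \<in> ideal.span ?I"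
    by (rule base[OF to_poly_to_face_ring_diff])
  ultimately show "p \<in> ideal.span ?I" using ideal.span_diff by fastforce
next
  assume "p \<in> ideal.span ?I"
  then show "to_face_ring \<Delta> p \<in> ideal_gen \<Delta> S"
  proof (induction p rule: ideal.span_induct_alt)
    case base
    have "to_face_ring \<Delta> 0 = (\<lambda>m. \<Sum>j<(0::nat). 0)"
      by (auto simp: to_face_ring_def restr_def)
    then show ?case unfolding ideal_gen_def by (intro CollectI exI[of _ "0::nat"]) simp
  next
    case (step c x y)
    then obtain n and r s :: "nat \<Rightarrow> 'w multiset \<Rightarrow> 'k" where rs: "\<And>j. j < n \<Longrightarrow> r j \<in> face_ring \<Delta> \<and> s j \<in> S"
      and y: "to_face_ring \<Delta> y = (\<lambda>m. \<Sum>j<n. fr_mult \<Delta> (r j) (s j) m)"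
      unfolding ideal_gen_def by blast
    from step(1) show ?case
    proof
      assume "x \<in> to_poly ` S"
      then obtain t where t: "t \<in> S" "x = to_poly t" by blast
      have cx: "to_face_ring \<Delta> (c * x) = fr_mult \<Delta> (to_face_ring \<Delta> c) t"
        using t S by (simp add: to_face_ring_mult[OF \<Delta>] to_face_ring_to_poly subsetD)
      have sum: "to_face_ring \<Delta> (c * x + y)
          = (\<lambda>m. \<Sum>j<Suc n. fr_mult \<Delta> ((r(n := to_face_ring \<Delta> c)) j) ((s(n := t)) j) m)"
        unfolding to_face_ring_add cx y by (simp add: add.commute)
      show ?thesis unfolding ideal_gen_def
        by (rule CollectI, rule exI[of _ "Suc n"], rule exI[of _ "r(n := to_face_ring \<Delta> c)"],
            rule exI[of _ "s(n := t)"]) (use sum rs t to_face_ring_mem in \<open>auto simp: less_Suc_eq\<close>)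
    next
      assume "x \<in> nonfaces \<Delta>"
      then have "to_face_ring \<Delta> (c * x) = (\<lambda>_. 0)"
        using nonfaces_mult[OF \<Delta>] by (simp add: to_face_ring_eq_zero_iff)
      then show ?thesis using step by (simp add: to_face_ring_add)
    qed
  qed
qed

lemma mem_ideal_gen_iff:
  assumes "simplicial_complex \<Delta>" and "S \<subseteq> face_ring \<Delta>" and "f \<in> face_ring \<Delta>"
  shows "f \<in> ideal_gen \<Delta> S \<longleftrightarrow> to_poly f \<in> ideal.span (to_poly ` S \<union> nonfaces \<Delta>)"
  using to_face_ring_mem_ideal_gen_iff[OF assms(1,2), of "to_poly f"] assms(3)
  by (simp add: to_face_ring_to_poly)

lemma face_ring_diff:
  assumes "f \<in> face_ring \<Delta>" and "g \<in> face_ring \<Delta>"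
  shows "(\<lambda>m. f m - g m) \<in> face_ring \<Delta>" and "to_poly (\<lambda>m. f m - g m) = to_poly f - to_poly g"
proof -
  have sub: "{m. f m - g m \<noteq> 0} \<subseteq> {m. f m \<noteq> 0} \<union> {m. g m \<noteq> 0}" by auto
  then have "finite {m. f m - g m \<noteq> 0}"
    by (rule finite_subset) (use assms in \<open>auto simp: face_ring_def\<close>)
  then show *: "(\<lambda>m. f m - g m) \<in> face_ring \<Delta>" using sub assms by (auto simp: face_ring_def)
  show "to_poly (\<lambda>m. f m - g m) = to_poly f - to_poly g"
    using lookup_to_poly[OF *] lookup_to_poly[OF assms(1)] lookup_to_poly[OF assms(2)]
    by (intro poly_mapping_eqI) (simp add: lookup_minus)
qed

lemma cong_mod_ideal_gen_iff:
  assumes "simplicial_complex \<Delta>" and "S \<subseteq> face_ring \<Delta>" and "f \<in> face_ring \<Delta>" and "g \<in> face_ring \<Delta>"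
  shows "cong_mod (ideal_gen \<Delta> S) f g \<longleftrightarrow> to_poly f - to_poly g \<in> ideal.span (to_poly ` S \<union> nonfaces \<Delta>)"
  unfolding cong_mod_def using mem_ideal_gen_iff[OF assms(1,2) face_ring_diff(1)[OF assms(3,4)]]
  by (simp add: face_ring_diff(2)[OF assms(3,4)])

section \<open>Linear forms and linear systems of parameters\<close>

lemma to_poly_linear_form:
  assumes \<Delta>: "simplicial_complex \<Delta>" and f: "f \<in> face_ring \<Delta>" and hom: "homog 1 f"
  shows "to_poly f = (\<Sum>w\<in>vertices \<Delta>. single {#w#} (f {#w#}))"
proof (rule poly_mapping_eqI)
  fix m
  have "lookup (\<Sum>w\<in>vertices \<Delta>. single {#w#} (f {#w#})) m = (\<Sum>w\<in>vertices \<Delta>. if {#w#} = m then f m else 0)"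
    by (auto simp: lookup_sum lookup_single when_def intro!: sum.cong)
  also have "\<dots> = f m"
  proof (cases "f m = 0")
    case True
    then show ?thesis by (simp add: sum.neutral)
  next
    case False
    then have "size m = 1" and "set_mset m \<in> \<Delta>" using f hom by (auto simp: homog_def face_ring_def)
    then obtain x where x: "m = {#x#}" "x \<in> vertices \<Delta>"
      using size_1_singleton_mset by (fastforce simp: vertices_def)
    then show ?thesis using finite_vertices[OF \<Delta>] by simp
  qed
  finally show "lookup (to_poly f) m = lookup (\<Sum>w\<in>vertices \<Delta>. single {#w#} (f {#w#})) m"
    by (simp add: lookup_to_poly[OF f])
qed

lemma subst_linear_form:
  assumes "simplicial_complex \<Delta>" and "f \<in> face_ring \<Delta>" and "homog 1 f"
  shows "subst g (to_poly f) = (\<Sum>w\<in>vertices \<Delta>. single 0 (f {#w#}) * g w)"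
  by (simp add: to_poly_linear_form[OF assms] subst_sum)

text \<open>A nonzero solution \<open>u\<close> would give the homomorphism sending \<open>x\<^sub>w\<close> to \<open>u w * t\<close> for
  \<open>w \<in> F\<close> and to \<open>0\<close> otherwise, which maps the finite-dimensional quotient onto \<open>k[t]\<close>.\<close>

lemma lsop_trivial_kernel:
  fixes \<theta> :: "nat \<Rightarrow> 'w multiset \<Rightarrow> 'k::field"
  assumes \<Delta>: "simplicial_complex \<Delta>" and lsop: "lsop \<Delta> \<theta> d" and F: "F \<in> \<Delta>"
    and ker: "\<And>i. i < d \<Longrightarrow> (\<Sum>w\<in>F. \<theta> i {#w#} * u w) = 0"
  shows "\<forall>w\<in>F. u w = 0"
proof (rule ccontr)
  assume "\<not> (\<forall>w\<in>F. u w = 0)"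
  then obtain t where t: "t \<in> F" "u t \<noteq> 0" by blast
  \<comment> \<open>The vertex \<open>t\<close> doubles as the indeterminate of \<open>k[t]\<close>,
    so the map stays in one polynomial type; \<open>u t \<noteq> 0\<close> keeps the powers of this
    variable from being sent to 0.\<close>
  define h where "h w = (if w \<in> F then single {#t#} (u w) else 0)" for w
  have \<theta>: "\<theta> i \<in> face_ring \<Delta>" "homog 1 (\<theta> i)" if "i < d" for i
    using lsop that by (auto simp: lsop_def)
  obtain S where S: "finite S" "S \<subseteq> face_ring \<Delta>"
    and gen: "\<And>p. p \<in> face_ring \<Delta> \<Longrightarrow>
        \<exists>c. cong_mod (ideal_gen \<Delta> (\<theta> ` {..<d})) p (\<lambda>m. \<Sum>s\<in>S. c s * s m)"
    using lsop by (auto simp: lsop_def)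
  have sub: "\<theta> ` {..<d} \<subseteq> face_ring \<Delta>" using \<theta> by auto
  \<comment> \<open>The span of the empty set is the zero ideal; in this form
    \<open>subst_mem_ideal\<close> applies.\<close>
  have kill: "subst h q \<in> ideal.span {}" if q: "q \<in> to_poly ` \<theta> ` {..<d} \<union> nonfaces \<Delta>" for q
    using q
  proof
    assume "q \<in> to_poly ` \<theta> ` {..<d}"
    then obtain i where i: "i < d" "q = to_poly (\<theta> i)" by auto
    have "subst h q = (\<Sum>w\<in>vertices \<Delta>. single 0 (\<theta> i {#w#}) * h w)"
      using subst_linear_form[OF \<Delta> \<theta>[OF i(1)]] i by simp
    also have "\<dots> = (\<Sum>w\<in>F. single 0 (\<theta> i {#w#}) * h w)"
      by (rule sum.mono_neutral_right)
        (use face_subset_vertices[OF \<Delta> F] finite_vertices[OF \<Delta>] in \<open>auto simp: h_def\<close>)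
    also have "\<dots> = (\<Sum>w\<in>F. single {#t#} (\<theta> i {#w#} * u w))"
      by (intro sum.cong) (auto simp: h_def mult_single)
    also have "\<dots> = single {#t#} (\<Sum>w\<in>F. \<theta> i {#w#} * u w)"
      by (induction F rule: infinite_finite_induct) (auto simp: single_add)
    also have "\<dots> = 0" by (simp add: ker[OF i(1)])
    finally show ?thesis by simp
  next
    assume q: "q \<in> nonfaces \<Delta>"
    have "subst h q = (\<Sum>m\<in>Poly_Mapping.keys q. 0)"
      unfolding subst_def
    proof (rule sum.cong[OF refl])
      fix m assume "m \<in> Poly_Mapping.keys q"
      then have "set_mset m \<notin> \<Delta>" using q by (auto simp: nonfaces_def in_keys_iff)
      \<comment> \<open>A nonface cannot lie inside \<open>F\<close>, so it contains a variable sent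
        to 0.\<close>
      then have "\<not> set_mset m \<subseteq> F" using simplicial_complex_subset[OF \<Delta> F] by blast
      then obtain w where "w \<in># m" "w \<notin> F" by blast
      then have "w \<in># m" "h w = 0" by (auto simp: h_def)
      then have "(\<Prod>w\<in>#m. h w) = 0" by (force simp: multi_member_split dest!: multi_member_split)
      then show "single 0 (lookup q m) * (\<Prod>w\<in>#m. h w) = 0" by simp
    qed
    then show ?thesis by simp
  qed
  have "finite (\<Union>s\<in>S. Poly_Mapping.keys (subst h (to_poly s)))" using S by simp
  then have "finite (size ` (\<Union>s\<in>S. Poly_Mapping.keys (subst h (to_poly s))))" by (rule finite_imageI)
  \<comment> \<open>A degree in which no image of a spanning element has a term, so the
    \<open>j\<close>-th power of the variable \<open>t\<close> is out of reach.\<close>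
  then obtain j where j: "j \<notin> size ` (\<Union>s\<in>S. Poly_Mapping.keys (subst h (to_poly s)))"
    using ex_new_if_finite[OF infinite_UNIV_nat] by blast
  define m where "m = replicate_mset j t"
  have "set_mset m \<in> \<Delta>" using simplicial_complex_subset[OF \<Delta> F] t by (auto simp: m_def)
  define p :: "'w multiset \<Rightarrow> 'k" where "p = lookup (single m 1)"
  have p: "p \<in> face_ring \<Delta>"
    using \<open>set_mset m \<in> \<Delta>\<close> by (auto simp: face_ring_def p_def lookup_single when_def)
  have pp: "to_poly p = single m 1" by (simp add: to_poly_def p_def lookup_inverse)
  obtain c where c: "cong_mod (ideal_gen \<Delta> (\<theta> ` {..<d})) p (\<lambda>m. \<Sum>s\<in>S. c s * s m)"
    using gen[OF p] by blast
  have fs: "(\<lambda>m. \<Sum>s\<in>S. c s * s m) \<in> face_ring \<Delta>" using S by (intro face_ring_sum) auto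
  have tps: "to_poly (\<lambda>m. \<Sum>s\<in>S. c s * s m) = (\<Sum>s\<in>S. single 0 (c s) * to_poly s)"
    using S by (intro to_poly_sum) auto
  have "single m 1 - (\<Sum>s\<in>S. single 0 (c s) * to_poly s)
      \<in> ideal.span (to_poly ` \<theta> ` {..<d} \<union> nonfaces \<Delta>)"
    using c cong_mod_ideal_gen_iff[OF \<Delta> sub p fs] pp tps by simp
  from subst_mem_ideal[OF this kill]
  have "subst h (single m 1) = (\<Sum>s\<in>S. single 0 (c s) * subst h (to_poly s))"
    by (simp add: subst_diff subst_sum subst_mult)
  moreover have "subst h (single m 1) = single m (u t ^ j)"
  proof -
    have "(\<Prod>w\<in>#replicate_mset j t. h w) = single (replicate_mset j t) (u t ^ j)"
      by (induction j) (auto simp: h_def t mult_single)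
    then show ?thesis by (simp add: m_def)
  qed
  \<comment> \<open>Comparing coefficients at \<open>m\<close>: the left side is nonzero, while
    every summand on the right is 0.\<close>
  ultimately have "u t ^ j = lookup (\<Sum>s\<in>S. single 0 (c s) * subst h (to_poly s)) m"
    by (metis lookup_single_eq)
  also have "\<dots> = (\<Sum>s\<in>S. c s * lookup (subst h (to_poly s)) m)"
    unfolding lookup_sum
    by (intro sum.cong refl) (simp flip: mult_map_scale_conv_mult add: Poly_Mapping.map.rep_eq when_def)
  also have "\<dots> = 0"
  proof (intro sum.neutral ballI)
    fix s assume "s \<in> S"
    then have "m \<notin> Poly_Mapping.keys (subst h (to_poly s))" 
      using j by (metis UN_I image_eqI m_def size_replicate_mset)
    then show "c s * lookup (subst h (to_poly s)) m = 0" by (simp add: in_keys_iff)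
  qed
  finally show False using t by simp
qed

section \<open>Projection of a face ring to the face ring of a link\<close>

lemma simplicial_complex_link:
  assumes "simplicial_complex \<Delta>" and "A \<in> \<Delta>"
  shows "simplicial_complex (link \<Delta> A)"
proof -
  have "G \<union> A \<in> \<Delta>" if "F \<union> A \<in> \<Delta>" "G \<subseteq> F" for F G
    by (rule simplicial_complex_subset[OF assms(1) that(1)]) (use that in auto)
  then show ?thesis using assms unfolding simplicial_complex_def link_def by auto
qed

lemma simplicial_complex_cstar:
  assumes "simplicial_complex \<Delta>" and "A \<in> \<Delta>"
  shows "simplicial_complex (cstar \<Delta> A)"
proof -
  have "G \<union> A \<in> \<Delta>" if "F \<union> A \<in> \<Delta>" "G \<subseteq> F" for F G
    by (rule simplicial_complex_subset[OF assms(1) that(1)]) (use that in auto)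
  then show ?thesis using assms unfolding simplicial_complex_def cstar_def by auto
qed

lemma link_link:
  assumes \<Gamma>: "simplicial_complex \<Gamma>" and "E \<subseteq> E'"
  shows "link (link \<Gamma> E) (E' - E) = link \<Gamma> E'"
proof -
  have "G \<union> (E' - E) \<in> \<Gamma>" "G \<union> E \<in> \<Gamma>" if "G \<union> E' \<in> \<Gamma>" for G
    by (rule simplicial_complex_subset[OF \<Gamma> that]; use assms(2) in auto)+
  moreover have "G \<union> (E' - E) \<union> E = G \<union> E'" for G using assms(2) by blast
  ultimately show ?thesis using assms(2) unfolding link_def by auto
qed

text \<open>Elimination of the variables in \<open>A\<close>: since the linear forms \<open>\<theta> r\<close>, \<open>r \<in> R\<close>, have an
  invertible coefficient matrix on \<open>A\<close>, modulo \<open>\<theta>\<close> every \<open>x\<^sub>a\<close> with \<open>a \<in> A\<close> is congruent to a linear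
  form on the link of \<open>A\<close>.\<close>

locale link_projection =
  fixes L :: "'w set set" and A :: "'w set" and \<theta> :: "nat \<Rightarrow> 'w multiset \<Rightarrow> 'k::field"
    and d :: nat and R :: "nat set" and M :: "'w \<Rightarrow> nat \<Rightarrow> 'k"
  assumes complex_L: "simplicial_complex L" and face_A: "A \<in> L"
    and \<theta>_face_ring: "i < d \<Longrightarrow> \<theta> i \<in> face_ring L" and \<theta>_homog: "i < d \<Longrightarrow> homog 1 (\<theta> i)"
    and R_subset: "R \<subseteq> {..<d}"
    and left_inverse: "a \<in> A \<Longrightarrow> b \<in> A \<Longrightarrow> (\<Sum>r\<in>R. M a r * \<theta> r {#b#}) = (if a = b then 1 else 0)"
    and right_inverse: "r \<in> R \<Longrightarrow> r' \<in> R \<Longrightarrow> (\<Sum>a\<in>A. \<theta> r {#a#} * M a r') = (if r = r' then 1 else 0)"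
begin

abbreviation L' :: "'w set set" where "L' \<equiv> link L A"

abbreviation St :: "'w set set" where "St \<equiv> cstar L A"

text \<open>On the star, \<open>\<theta> r\<close> is its part on \<open>A\<close> plus its
  restriction to \<open>L'\<close>; setting these forms to 0 and applying the inverse matrix
  \<open>M\<close> solves for the variable \<open>a\<close>.\<close>

definition lin :: "'w \<Rightarrow> 'w multiset \<Rightarrow>\<^sub>0 'k" where
  "lin a = - (\<Sum>r\<in>R. single 0 (M a r) * to_poly (restr L' (\<theta> r)))"

definition elim :: "'w \<Rightarrow> 'w multiset \<Rightarrow>\<^sub>0 'k" where
  "elim w = (if w \<in> A then lin w else single {#w#} 1)"

definition phi :: "('w multiset \<Rightarrow> 'k) \<Rightarrow> 'w multiset \<Rightarrow> 'k" where
  "phi f = to_face_ring L' (subst elim (to_poly f))"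

text \<open>The preimage in the polynomial ring of the ideal of \<open>k[St]\<close> generated by
  the restricted forms: the unrestricted \<open>\<theta> i\<close> serve as well, since they differ
  from the restrictions by nonfaces of \<open>St\<close>.\<close>

definition star_ideal :: "('w multiset \<Rightarrow>\<^sub>0 'k) set" where
  "star_ideal = ideal.span (to_poly ` \<theta> ` {..<d} \<union> nonfaces St)"

lemma complex_L': "simplicial_complex L'"
  by (rule simplicial_complex_link[OF complex_L face_A])

lemma complex_St: "simplicial_complex St"
  by (rule simplicial_complex_cstar[OF complex_L face_A])

lemma L'_subset_St: "L' \<subseteq> St" and St_subset_L: "St \<subseteq> L"
  by (auto simp: link_def cstar_def)

lemma L'_subset_L: "L' \<subseteq> L"
  by (auto simp: link_def)

lemma finite_A: "finite A"
  by (rule simplicial_complex_finite_face[OF complex_L face_A])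

lemma finite_R: "finite R"
  using R_subset finite_subset by blast

lemma star_disjoint_iff: "G \<inter> A = {} \<Longrightarrow> G \<in> St \<longleftrightarrow> G \<in> L'"
  by (auto simp: link_def cstar_def)

lemma union_A_mem_St: "G \<in> L' \<Longrightarrow> F \<subseteq> G \<union> A \<Longrightarrow> F \<in> St"
  using simplicial_complex_subset[OF complex_L, of "G \<union> A"]
  by (auto simp: link_def cstar_def)

lemma restr_\<theta>: "i < d \<Longrightarrow> \<Delta> \<subseteq> L \<Longrightarrow> restr \<Delta> (\<theta> i) = to_face_ring \<Delta> (to_poly (\<theta> i))"
  by (simp add: to_face_ring_def lookup_to_poly[OF \<theta>_face_ring])

lemma restr_\<theta>_mem: "i < d \<Longrightarrow> \<Delta> \<subseteq> L \<Longrightarrow> restr \<Delta> (\<theta> i) \<in> face_ring \<Delta>"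
  by (simp add: restr_\<theta> to_face_ring_mem)

section \<open>Polynomials free of the variables in \<open>A\<close>\<close>

definition avoiding :: "('w multiset \<Rightarrow>\<^sub>0 'k) set" where
  "avoiding = {p. \<forall>m. lookup p m \<noteq> 0 \<longrightarrow> set_mset m \<inter> A = {}}"

lemma avoiding_add: "p \<in> avoiding \<Longrightarrow> q \<in> avoiding \<Longrightarrow> p + q \<in> avoiding"
  by (auto simp: avoiding_def lookup_add) (metis add.right_neutral disjoint_iff)

lemma avoiding_diff: "p \<in> avoiding \<Longrightarrow> q \<in> avoiding \<Longrightarrow> p - q \<in> avoiding"
  by (auto simp: avoiding_def lookup_minus) (metis diff_zero disjoint_iff)

lemma avoiding_uminus: "p \<in> avoiding \<Longrightarrow> - p \<in> avoiding"
  by (auto simp: avoiding_def)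

lemma avoiding_mult:
  assumes "p \<in> avoiding" and "q \<in> avoiding"
  shows "p * q \<in> avoiding"
proof -
  have "set_mset m \<inter> A = {}" if "m \<in> Poly_Mapping.keys (p * q)" for m
  proof -
    obtain a b where "m = a + b" "a \<in> Poly_Mapping.keys p" "b \<in> Poly_Mapping.keys q"
      using keys_mult[of p q] \<open>m \<in> Poly_Mapping.keys (p * q)\<close> by blast
    then show ?thesis using assms by (auto simp: avoiding_def in_keys_iff)
  qed
  then show ?thesis by (auto simp: avoiding_def in_keys_iff)
qed

lemma avoiding_const: "single 0 c \<in> avoiding"
  by (auto simp: avoiding_def lookup_single when_def)

lemma to_poly_avoiding:
  assumes "f \<in> face_ring L'"
  shows "to_poly f \<in> avoiding"
  using assms lookup_to_poly[OF assms] by (auto simp: avoiding_def face_ring_def link_def)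

lemma lin_avoiding: "lin a \<in> avoiding"
proof -
  have "(\<Sum>r\<in>R'. single 0 (M a r) * to_poly (restr L' (\<theta> r))) \<in> avoiding" if "finite R'" "R' \<subseteq> {..<d}" for R'
    using that
  proof (induction R' rule: finite_induct)
    case empty
    show ?case using avoiding_const[of 0] by simp
  next
    case (insert r R')
    then show ?case
      by (auto intro!: avoiding_add avoiding_mult avoiding_const to_poly_avoiding restr_\<theta>_mem L'_subset_L)
  qed
  then show ?thesis unfolding lin_def using finite_R R_subset by (intro avoiding_uminus)
qed

lemma subst_elim_avoiding: "subst elim p \<in> avoiding"
proof (rule subst_mem_closed)
  show "elim w \<in> avoiding" for w
    using lin_avoiding by (auto simp: elim_def avoiding_def lookup_single when_def)
qed (auto intro: avoiding_const avoiding_add avoiding_mult)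

lemma subst_elim_id:
  assumes "p \<in> avoiding"
  shows "subst elim p = p"
proof -
  have "single 0 (lookup p m) * (\<Prod>w\<in>#m. elim w) = single m (lookup p m)" if "m \<in> Poly_Mapping.keys p" for m
  proof -
    have "set_mset m \<inter> A = {}" using that assms by (auto simp: avoiding_def in_keys_iff)
    then have "image_mset elim m = image_mset (\<lambda>w. single {#w#} 1) m"
      by (intro image_mset_cong) (auto simp: elim_def)
    then show ?thesis by (simp add: prod_mset_variables mult_single)
  qed
  then show ?thesis unfolding subst_def by (simp add: sum_single_lookup)
qed

text \<open>For a monomial disjoint from \<open>A\<close>, lying in the star and lying in the link
  are the same. In general this fails: a variable in \<open>A\<close> is a nonface of
  \<open>L'\<close> but a face of \<open>St\<close>.\<close>

lemma avoiding_nonfaces: "p \<in> avoiding \<Longrightarrow> p \<in> nonfaces L' \<Longrightarrow> p \<in> nonfaces St"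
  using star_disjoint_iff by (auto simp: avoiding_def nonfaces_def)

text \<open>Strip the \<open>A\<close>-part from a monomial off the star: what remains is untouched
  by \<open>elim\<close> and is off the link, since a face of the link joined with \<open>A\<close>
  lies in the star.\<close>

lemma subst_elim_nonfaces:
  assumes "p \<in> nonfaces St"
  shows "subst elim p \<in> nonfaces L'"
proof -
  have summand: "single 0 (lookup p m) * (\<Prod>w\<in>#m. elim w) \<in> nonfaces L'" if "m \<in> Poly_Mapping.keys p" for m
  proof -
    let ?n = "filter_mset (\<lambda>w. w \<notin> A) m" and ?a = "filter_mset (\<lambda>w. w \<in> A) m"
    have "set_mset m \<notin> St" using assms that by (auto simp: nonfaces_def in_keys_iff)
    then have "set_mset ?n \<notin> L'" using union_A_mem_St[of "set_mset ?n" "set_mset m"] by auto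
    then have "(single ?n 1 :: 'w multiset \<Rightarrow>\<^sub>0 'k) \<in> nonfaces L'"
      by (auto simp: nonfaces_def lookup_single when_def)
    then have "(single 0 (lookup p m) * (\<Prod>w\<in>#?a. elim w)) * single ?n 1 \<in> nonfaces L'"
      by (rule nonfaces_mult[OF complex_L'])
    moreover have "(\<Prod>w\<in>#m. elim w) = (\<Prod>w\<in>#?a. elim w) * single ?n 1"
    proof -
      have "image_mset elim ?n = image_mset (\<lambda>w. single {#w#} 1) ?n"
        by (intro image_mset_cong) (auto simp: elim_def)
      moreover have "m = ?a + ?n" by (rule multiset_partition)
      ultimately show ?thesis by (metis image_mset_union prod_mset_Un prod_mset_variables)
    qed
    ultimately show ?thesis by (simp only: mult.assoc)
  qed
  have "(\<Sum>m\<in>K. single 0 (lookup p m) * (\<Prod>w\<in>#m. elim w)) \<in> nonfaces L'"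
    if "finite K" "K \<subseteq> Poly_Mapping.keys p" for K
    using that
  proof (induction K rule: finite_induct)
    case empty
    show ?case by (simp add: nonfaces_def)
  next
    case (insert m K)
    then show ?case using summand by (auto intro: nonfaces_add)
  qed
  then show ?thesis unfolding subst_def by simp
qed

lemma nonfaces_star_ideal: "p \<in> nonfaces St \<Longrightarrow> p \<in> star_ideal"
  unfolding star_ideal_def by (rule ideal.span_base) simp

lemma \<theta>_star_ideal: "i < d \<Longrightarrow> to_poly (\<theta> i) \<in> star_ideal"
  unfolding star_ideal_def by (rule ideal.span_base) simp

text \<open>The part of the form on vertices outside the star, a vertex of the star being either in
  \<open>A\<close> or in \<open>L'\<close>.\<close>

definition offstar :: "nat \<Rightarrow> 'w multiset \<Rightarrow>\<^sub>0 'k" where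
  "offstar i = to_poly (\<theta> i) - (\<Sum>a\<in>A. single {#a#} (\<theta> i {#a#})) - to_poly (restr L' (\<theta> i))"

lemma offstar_nonfaces:
  assumes "i < d"
  shows "offstar i \<in> nonfaces St"
proof -
  have "lookup (offstar i) m = 0" if "set_mset m \<in> St" for m
  proof -
    have eq: "lookup (offstar i) m = \<theta> i m - (\<Sum>a\<in>A. if {#a#} = m then \<theta> i m else 0) - restr L' (\<theta> i) m"
      by (auto simp: offstar_def lookup_minus lookup_sum lookup_single when_def assms
          lookup_to_poly[OF \<theta>_face_ring] lookup_to_poly[OF restr_\<theta>_mem[OF _ L'_subset_L]] intro!: sum.cong)
    show ?thesis
    proof (cases "\<theta> i m = 0")
      case True
      then show ?thesis unfolding eq by (simp add: sum.neutral restr_def)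
    next
      case False
      then have "size m = 1" using \<theta>_homog[OF assms] by (simp add: homog_def)
      then obtain w where w: "m = {#w#}" using size_1_singleton_mset by blast
      show ?thesis
      proof (cases "w \<in> A")
        case True
        then have "{w} \<notin> L'" by (auto simp: link_def)
        then show ?thesis unfolding eq using True finite_A by (simp add: w restr_def)
      next
        case False
        then have "{w} \<in> L'" using that w star_disjoint_iff[of "{w}"] by simp
        moreover have "(\<Sum>a\<in>A. if {#a#} = m then \<theta> i m else 0) = 0"
          using False w by (intro sum.neutral) auto
        ultimately show ?thesis unfolding eq by (simp add: w restr_def)
      qed
    qed
  qed
  then show ?thesis by (auto simp: nonfaces_def)
qed

lemma \<theta>_decomp:
  "to_poly (\<theta> i) = (\<Sum>a\<in>A. single {#a#} (\<theta> i {#a#})) + to_poly (restr L' (\<theta> i)) + offstar i"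
  by (simp add: offstar_def)

text \<open>The combination of the \<open>\<theta> r\<close> with coefficients \<open>M a r\<close>
  has as \<open>A\<close>-part the variable \<open>a\<close>, by \<open>left_inverse\<close>, and as
  link part \<open>- lin a\<close>; the rest is off the star.\<close>

lemma variable_minus_lin:
  assumes "a \<in> A"
  shows "single {#a#} 1 - lin a \<in> star_ideal"
proof -
  have "(\<Sum>r\<in>R. single 0 (M a r) * (\<Sum>b\<in>A. single {#b#} (\<theta> r {#b#}))) = (\<Sum>b\<in>A. \<Sum>r\<in>R. single {#b#} (M a r * \<theta> r {#b#}))"
    by (subst sum.swap) (simp add: sum_distrib_left mult_single)
  also have "\<dots> = (\<Sum>b\<in>A. single {#b#} (\<Sum>r\<in>R. M a r * \<theta> r {#b#}))"
    by (intro sum.cong refl, rule poly_mapping_eqI) (auto simp: lookup_sum lookup_single when_def)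
  also have "\<dots> = (\<Sum>b\<in>A. if a = b then single {#b#} 1 else 0)"
    using left_inverse[OF assms] by (intro sum.cong) auto
  also have "\<dots> = single {#a#} 1" using assms finite_A by simp
  finally have "(\<Sum>r\<in>R. single 0 (M a r) * (\<Sum>b\<in>A. single {#b#} (\<theta> r {#b#}))) = single {#a#} 1" .
  then have eq: "single {#a#} 1 - lin a
      = (\<Sum>r\<in>R. single 0 (M a r) * to_poly (\<theta> r)) - (\<Sum>r\<in>R. single 0 (M a r) * offstar r)"
    unfolding \<theta>_decomp lin_def by (simp add: distrib_left sum.distrib)
  show ?thesis unfolding eq star_ideal_def
    by (intro ideal.span_diff ideal.span_sum ideal.span_scale)
      (use R_subset offstar_nonfaces nonfaces_star_ideal \<theta>_star_ideal in \<open>auto simp: star_ideal_def\<close>)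
qed

lemma subst_elim_cong: "p - subst elim p \<in> star_ideal"
  unfolding star_ideal_def
proof (rule diff_subst_mem_ideal)
  show "single {#w#} 1 - elim w \<in> ideal.span (to_poly ` \<theta> ` {..<d} \<union> nonfaces St)" for w
    using variable_minus_lin[of w] by (auto simp: elim_def star_ideal_def ideal.span_zero)
qed

text \<open>The terms discarded by the final truncation are nonfaces of \<open>L'\<close> that avoid
  \<open>A\<close>, hence already nonfaces of \<open>St\<close>.\<close>

lemma to_face_ring_subst_elim_cong: "p - to_poly (to_face_ring L' (subst elim p)) \<in> star_ideal"
proof -
  have "to_poly (to_face_ring L' (subst elim p)) - subst elim p \<in> nonfaces St"
    by (intro avoiding_nonfaces avoiding_diff to_poly_avoiding to_face_ring_mem subst_elim_avoiding
        to_poly_to_face_ring_diff)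
  then have "(p - subst elim p) - (to_poly (to_face_ring L' (subst elim p)) - subst elim p) \<in> star_ideal"
    using subst_elim_cong[of p] nonfaces_star_ideal unfolding star_ideal_def by (blast intro: ideal.span_diff)
  then show ?thesis by simp
qed

lemma phi_mem: "phi f \<in> face_ring L'"
  by (simp add: phi_def to_face_ring_mem)

lemma phi_cong: "to_poly f - to_poly (phi f) \<in> star_ideal"
  unfolding phi_def by (rule to_face_ring_subst_elim_cong)

text \<open>The passage from the star ideal down to the link: generators go to the forms
  \<open>phi (\<theta> i)\<close> up to nonfaces of \<open>L'\<close>, and monomials off the star go
  to nonfaces of \<open>L'\<close>.\<close>

lemma subst_elim_star_ideal:
  assumes "p \<in> star_ideal"
  shows "subst elim p \<in> ideal.span (to_poly ` (\<lambda>i. phi (\<theta> i)) ` {..<d} \<union> nonfaces L')" (is "_ \<in> ideal.span ?I")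
proof (rule subst_mem_ideal)
  show "p \<in> ideal.span (to_poly ` \<theta> ` {..<d} \<union> nonfaces St)" using assms by (simp add: star_ideal_def)
  fix q assume "q \<in> to_poly ` \<theta> ` {..<d} \<union> nonfaces St"
  then show "subst elim q \<in> ideal.span ?I"
  proof
    assume "q \<in> to_poly ` \<theta> ` {..<d}"
    then obtain i where i: "i < d" "q = to_poly (\<theta> i)" by auto
    have "to_poly (phi (\<theta> i)) \<in> ideal.span ?I" using i by (intro ideal.span_base) auto
    moreover have "to_poly (phi (\<theta> i)) - subst elim q \<in> ideal.span ?I"
      unfolding phi_def i by (rule ideal.span_base) (simp add: to_poly_to_face_ring_diff)
    ultimately have "to_poly (phi (\<theta> i)) - (to_poly (phi (\<theta> i)) - subst elim q) \<in> ideal.span ?I"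
      by (rule ideal.span_diff)
    then show ?thesis by simp
  next
    assume "q \<in> nonfaces St"
    then show ?thesis using subst_elim_nonfaces by (intro ideal.span_base) auto
  qed
qed

lemma phi_id: "f \<in> face_ring L' \<Longrightarrow> phi f = f"
  by (simp add: phi_def subst_elim_id to_poly_avoiding to_face_ring_to_poly)

lemma fr_mult_L'_cong:
  assumes "f \<in> face_ring L'" and "g \<in> face_ring L'"
  shows "to_poly (fr_mult L' f g) - to_poly f * to_poly g \<in> star_ideal"
  unfolding fr_mult_eq_to_face_ring[OF complex_L' assms]
  by (intro nonfaces_star_ideal avoiding_nonfaces avoiding_diff avoiding_mult to_poly_avoiding
      to_face_ring_mem assms to_poly_to_face_ring_diff)

lemma fr_mult_L'_mem: "f \<in> face_ring L' \<Longrightarrow> g \<in> face_ring L' \<Longrightarrow> fr_mult L' f g \<in> face_ring L'"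
  by (simp add: fr_mult_eq_to_face_ring[OF complex_L'] to_face_ring_mem)

lemma fr_mult_L'_star_ideal:
  assumes "f \<in> face_ring L'" and "g \<in> face_ring L'" and "to_poly g \<in> star_ideal"
  shows "to_poly (fr_mult L' f g) \<in> star_ideal"
proof -
  have "(to_poly (fr_mult L' f g) - to_poly f * to_poly g) + to_poly f * to_poly g \<in> star_ideal"
    using fr_mult_L'_cong[OF assms(1,2)] assms(3) unfolding star_ideal_def
    by (intro ideal.span_add ideal.span_scale)
  then show ?thesis by simp
qed

text \<open>Together with \<open>mem_star_ideal_gen_iff\<close> this identifies the contraction.
  Forward, \<open>phi (\<theta> i)\<close> is congruent to \<open>\<theta> i\<close> modulo the star
  ideal; backward, elimination fixes \<open>f\<close> while pushing the star ideal into the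
  link.\<close>

lemma mem_ideal_gen_phi_iff:
  assumes f: "f \<in> face_ring L'"
  shows "f \<in> ideal_gen L' ((\<lambda>i. phi (\<theta> i)) ` {..<d}) \<longleftrightarrow> to_poly f \<in> star_ideal"
proof
  assume "f \<in> ideal_gen L' ((\<lambda>i. phi (\<theta> i)) ` {..<d})"
  then obtain n and r s :: "nat \<Rightarrow> 'w multiset \<Rightarrow> 'k"
    where rs: "\<And>j. j < n \<Longrightarrow> r j \<in> face_ring L' \<and> s j \<in> (\<lambda>i. phi (\<theta> i)) ` {..<d}"
    and eq: "f = (\<lambda>m. \<Sum>j<n. fr_mult L' (r j) (s j) m)"
    unfolding ideal_gen_def by blast
  have s: "s j \<in> face_ring L'" "to_poly (s j) \<in> star_ideal" if j: "j < n" for j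
  proof -
    obtain i where i: "i < d" "s j = phi (\<theta> i)" using rs[OF j] by auto
    have "to_poly (\<theta> i) - (to_poly (\<theta> i) - to_poly (phi (\<theta> i))) \<in> star_ideal"
      using \<theta>_star_ideal[OF i(1)] phi_cong unfolding star_ideal_def by (rule ideal.span_diff)
    then show "to_poly (s j) \<in> star_ideal" by (simp add: i)
    show "s j \<in> face_ring L'" by (simp add: i phi_mem)
  qed
  have "to_poly f = (\<Sum>j<n. to_poly (fr_mult L' (r j) (s j)))"
    unfolding eq using to_poly_sum[of "{..<n}" "\<lambda>j. fr_mult L' (r j) (s j)" L' "\<lambda>_. 1"] fr_mult_L'_mem rs s
    by auto
  moreover have "(\<Sum>j<n. to_poly (fr_mult L' (r j) (s j))) \<in> star_ideal"
    using rs s fr_mult_L'_star_ideal unfolding star_ideal_def by (intro ideal.span_sum) auto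
  ultimately show "to_poly f \<in> star_ideal" by simp
next
  assume "to_poly f \<in> star_ideal"
  from subst_elim_star_ideal[OF this]
  have "to_poly f \<in> ideal.span (to_poly ` (\<lambda>i. phi (\<theta> i)) ` {..<d} \<union> nonfaces L')"
    by (simp add: subst_elim_id to_poly_avoiding f)
  then show "f \<in> ideal_gen L' ((\<lambda>i. phi (\<theta> i)) ` {..<d})"
    by (subst mem_ideal_gen_iff[OF complex_L' _ f]) (auto simp: phi_mem)
qed

lemma mem_star_ideal_gen_iff:
  assumes f: "f \<in> face_ring L'"
  shows "f \<in> ideal_gen St ((\<lambda>i. restr St (\<theta> i)) ` {..<d}) \<longleftrightarrow> to_poly f \<in> star_ideal"
proof -
  have f': "f \<in> face_ring St" using f face_ring_mono[OF L'_subset_St] by blast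
  let ?S = "(\<lambda>i. restr St (\<theta> i)) ` {..<d}"
  have diff: "to_poly (restr St (\<theta> i)) - to_poly (\<theta> i) \<in> nonfaces St" if "i < d" for i
    unfolding restr_\<theta>[OF that St_subset_L] by (rule to_poly_to_face_ring_diff)
  have "ideal.span (to_poly ` ?S \<union> nonfaces St) = star_ideal"
    unfolding star_ideal_def ideal.span_eq
  proof (intro conjI Un_least)
    show "to_poly ` ?S \<subseteq> ideal.span (to_poly ` \<theta> ` {..<d} \<union> nonfaces St)"
    proof (intro subsetI)
      fix p assume "p \<in> to_poly ` ?S"
      then obtain i where i: "i < d" "p = to_poly (restr St (\<theta> i))" by auto
      have "(p - to_poly (\<theta> i)) + to_poly (\<theta> i) \<in> ideal.span (to_poly ` \<theta> ` {..<d} \<union> nonfaces St)"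
        using i diff by (intro ideal.span_add; intro ideal.span_base) auto
      then show "p \<in> ideal.span (to_poly ` \<theta> ` {..<d} \<union> nonfaces St)" by simp
    qed
    show "to_poly ` \<theta> ` {..<d} \<subseteq> ideal.span (to_poly ` ?S \<union> nonfaces St)"
    proof (intro subsetI)
      fix p assume "p \<in> to_poly ` \<theta> ` {..<d}"
      then obtain i where i: "i < d" "p = to_poly (\<theta> i)" by auto
      have "to_poly (restr St (\<theta> i)) - (to_poly (restr St (\<theta> i)) - p) \<in> ideal.span (to_poly ` ?S \<union> nonfaces St)"
        
        by (rule ideal.span_diff; rule ideal.span_base) (use i diff in auto)
      then show "p \<in> ideal.span (to_poly ` ?S \<union> nonfaces St)" by simp
    qed
  qed (auto intro: ideal.span_base)
  then show ?thesis
    using mem_ideal_gen_iff[OF complex_St _ f', of ?S] restr_\<theta>_mem[OF _ St_subset_L] by auto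
qed

lemma phi_\<theta>_eq:
  assumes "i < d"
  shows "phi (\<theta> i) = to_face_ring L' (to_poly (restr L' (\<theta> i)) + (\<Sum>a\<in>A. single 0 (\<theta> i {#a#}) * lin a))"
proof -
  have "subst elim (to_poly (\<theta> i)) = (\<Sum>a\<in>A. single 0 (\<theta> i {#a#}) * lin a) + to_poly (restr L' (\<theta> i)) + subst elim (offstar i)"
    by (subst \<theta>_decomp) (simp add: subst_add subst_sum elim_def
      subst_elim_id[OF to_poly_avoiding[OF restr_\<theta>_mem[OF assms L'_subset_L]]])
  then show ?thesis unfolding phi_def
    using subst_elim_nonfaces[OF offstar_nonfaces[OF assms]] by (intro to_face_ring_cong) (simp add: algebra_simps)
qed

lemma phi_\<theta>_zero_on_A:
  assumes "i < d" and "\<And>a. a \<in> A \<Longrightarrow> \<theta> i {#a#} = 0"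
  shows "phi (\<theta> i) = restr L' (\<theta> i)"
  using assms restr_\<theta>_mem[OF assms(1) L'_subset_L] by (simp add: phi_\<theta>_eq to_face_ring_to_poly)

text \<open>By \<open>right_inverse\<close> the linear forms substituted for \<open>A\<close> in
  \<open>\<theta> r\<close> add up to minus its restriction to \<open>L'\<close>, so everything
  cancels.\<close>

lemma phi_\<theta>_R:
  assumes "r \<in> R"
  shows "phi (\<theta> r) = (\<lambda>_. 0)"
proof -
  let ?l = "\<lambda>r. to_poly (restr L' (\<theta> r))"
  have "(\<Sum>a\<in>A. single 0 (\<theta> r {#a#}) * lin a) = - (\<Sum>a\<in>A. \<Sum>r'\<in>R. single 0 (\<theta> r {#a#} * M a r') * ?l r')"
    by (simp add: lin_def sum_negf sum_distrib_left mult_single flip: mult.assoc)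
  also have "(\<Sum>a\<in>A. \<Sum>r'\<in>R. single 0 (\<theta> r {#a#} * M a r') * ?l r')
      = (\<Sum>r'\<in>R. (\<Sum>a\<in>A. single 0 (\<theta> r {#a#} * M a r')) * ?l r')"
    by (subst sum.swap) (simp add: sum_distrib_right)
  also have "\<dots> = (\<Sum>r'\<in>R. if r = r' then ?l r' else 0)"
  proof (intro sum.cong refl)
    fix r' assume "r' \<in> R"
    have "(\<Sum>a\<in>A. single 0 (\<theta> r {#a#} * M a r')) = single (0 :: 'w multiset) (\<Sum>a\<in>A. \<theta> r {#a#} * M a r')"
      by (rule poly_mapping_eqI) (auto simp: lookup_sum lookup_single when_def)
    then show "(\<Sum>a\<in>A. single 0 (\<theta> r {#a#} * M a r')) * ?l r' = (if r = r' then ?l r' else 0)"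
      using right_inverse[OF assms \<open>r' \<in> R\<close>] by simp
  qed
  also have "\<dots> = ?l r" using assms finite_R by simp
  finally show ?thesis using assms R_subset
    by (subst phi_\<theta>_eq) (auto simp: to_face_ring_eq_zero_iff nonfaces_def)
qed

end

lemma ideal_gen_subset_face_ring:
  assumes "simplicial_complex \<Delta>" and "S \<subseteq> face_ring \<Delta>"
  shows "ideal_gen \<Delta> S \<subseteq> face_ring \<Delta>"
proof
  fix p assume "p \<in> ideal_gen \<Delta> S"
  then obtain n r s where rs: "\<forall>j<(n::nat). r j \<in> face_ring \<Delta> \<and> s j \<in> S"
    and p: "p = (\<lambda>m. \<Sum>j<n. fr_mult \<Delta> (r j) (s j) m)"
    unfolding ideal_gen_def by blast
  have "fr_mult \<Delta> (r j) (s j) \<in> face_ring \<Delta>" if "j < n" for j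
    using rs that assms(2) fr_mult_eq_to_face_ring[OF assms(1)] to_face_ring_mem by (metis subsetD)
  then show "p \<in> face_ring \<Delta>"
    using face_ring_sum[of "{..<n}" "\<lambda>j. fr_mult \<Delta> (r j) (s j)" \<Delta> "\<lambda>_. 1"] p by simp
qed

text \<open>Serves to discard the vanishing forms \<open>phi (\<theta> r)\<close> with
  \<open>r \<in> R\<close>, which cuts the number of generators from d to d'.\<close>

lemma ideal_gen_remove_zero:
  assumes \<Delta>: "simplicial_complex \<Delta>" and S: "S \<subseteq> face_ring \<Delta>"
    and "T \<subseteq> S" and "S \<subseteq> insert (\<lambda>_. 0) T"
  shows "ideal_gen \<Delta> T = ideal_gen \<Delta> S"
proof -
  have T: "T \<subseteq> face_ring \<Delta>" using assms by blast
  have "to_poly (\<lambda>_. 0) = (0 :: 'a multiset \<Rightarrow>\<^sub>0 'b)" by (simp add: to_poly_def)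
  then have "to_poly ` S \<subseteq> insert 0 (to_poly ` T)" using assms(4) by (auto simp: image_iff)
  then have "ideal.span (to_poly ` T \<union> nonfaces \<Delta>) = ideal.span (to_poly ` S \<union> nonfaces \<Delta>)"
    unfolding ideal.span_eq
  proof (intro conjI)
    show "to_poly ` T \<union> nonfaces \<Delta> \<subseteq> ideal.span (to_poly ` S \<union> nonfaces \<Delta>)"
      by (rule order.trans[OF _ ideal.span_superset]) (use assms(3) in auto)
    have "insert 0 (to_poly ` T \<union> nonfaces \<Delta>) \<subseteq> ideal.span (to_poly ` T \<union> nonfaces \<Delta>)"
      using ideal.span_superset ideal.span_zero by (intro insert_subsetI)
    then show "to_poly ` S \<union> nonfaces \<Delta> \<subseteq> ideal.span (to_poly ` T \<union> nonfaces \<Delta>)"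
      by (rule order.trans[rotated]) (use \<open>to_poly ` S \<subseteq> insert 0 (to_poly ` T)\<close> in auto)
  qed
  then show ?thesis
    using mem_ideal_gen_iff[OF \<Delta> S] mem_ideal_gen_iff[OF \<Delta> T]
      ideal_gen_subset_face_ring[OF \<Delta> S] ideal_gen_subset_face_ring[OF \<Delta> T] by blast
qed

lemma to_poly_lookup: "to_poly (lookup p) = p"
  by (simp add: to_poly_def lookup_inverse)

lemma to_poly_xmon:
  assumes "finite F"
  shows "to_poly (xmon F) = (single (mset_set F) 1 :: 'w multiset \<Rightarrow>\<^sub>0 'k::field)"
proof -
  have "lookup (to_poly (xmon F :: 'w multiset \<Rightarrow> 'k)) = xmon F"
    by (rule lookup_to_poly[of _ "{F}"]) (simp add: xmon_mem_face_ring assms)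
  then show ?thesis by (intro poly_mapping_eqI) (auto simp: xmon_def lookup_single when_def)
qed

lemma homog_mult:
  fixes p q :: "'w multiset \<Rightarrow>\<^sub>0 'k::field"
  assumes "homog i (lookup p)" and "homog j (lookup q)"
  shows "homog (i + j) (lookup (p * q))"
  unfolding homog_def
proof (intro allI impI)
  fix m assume "lookup (p * q) m \<noteq> 0"
  then have "m \<in> Poly_Mapping.keys (p * q)" by (simp add: in_keys_iff)
  then obtain a b where "m = a + b" "a \<in> Poly_Mapping.keys p" "b \<in> Poly_Mapping.keys q"
    using keys_mult[of p q] by blast
  then show "size m = i + j" using assms by (auto simp: homog_def in_keys_iff)
qed

section \<open>The induced homomorphism and its uniqueness\<close>

context link_projection
begin

abbreviation J :: "('w multiset \<Rightarrow> 'k) set" where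
  "J \<equiv> {f \<in> face_ring L'. f \<in> ideal_gen St ((\<lambda>i. restr St (\<theta> i)) ` {..<d})}"

abbreviation I :: "('w multiset \<Rightarrow> 'k) set" where
  "I \<equiv> ideal_gen L (\<theta> ` {..<d})"

lemma star_ideal_add: "p \<in> star_ideal \<Longrightarrow> q \<in> star_ideal \<Longrightarrow> p + q \<in> star_ideal"
  unfolding star_ideal_def by (rule ideal.span_add)

lemma star_ideal_diff: "p \<in> star_ideal \<Longrightarrow> q \<in> star_ideal \<Longrightarrow> p - q \<in> star_ideal"
  unfolding star_ideal_def by (rule ideal.span_diff)

lemma cong_mod_J_iff:
  assumes "f \<in> face_ring L'" and "g \<in> face_ring L'"
  shows "cong_mod J f g \<longleftrightarrow> to_poly f - to_poly g \<in> star_ideal"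
  unfolding cong_mod_def using mem_star_ideal_gen_iff[OF face_ring_diff(1)[OF assms]]
  by (simp add: face_ring_diff[OF assms])

lemma cong_mod_J_refl: "f \<in> face_ring L' \<Longrightarrow> cong_mod J f f"
  by (simp add: cong_mod_J_iff star_ideal_def ideal.span_zero)

lemma J_eq: "J = ideal_gen L' ((\<lambda>i. phi (\<theta> i)) ` {..<d})"
  using mem_ideal_gen_phi_iff mem_star_ideal_gen_iff
    ideal_gen_subset_face_ring[OF complex_L', of "(\<lambda>i. phi (\<theta> i)) ` {..<d}"] phi_mem by blast

lemma \<theta>_image_subset: "\<theta> ` {..<d} \<subseteq> face_ring L"
  using \<theta>_face_ring by auto

lemma ideal_L_subset_star_ideal: "ideal.span (to_poly ` \<theta> ` {..<d} \<union> nonfaces L) \<subseteq> star_ideal"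
  unfolding star_ideal_def by (rule ideal.span_mono) (use nonfaces_antimono[OF St_subset_L] in blast)

lemma phi_add:
  assumes "f \<in> face_ring L" and "g \<in> face_ring L"
  shows "phi (\<lambda>m. f m + g m) = (\<lambda>m. phi f m + phi g m)"
  by (simp add: phi_def to_poly_add[OF assms] subst_add to_face_ring_add)

text \<open>All three of \<open>f - g\<close>, \<open>f - phi f\<close> and \<open>g - phi g\<close>
  lie in the star ideal, which contains the lift of \<open>I\<close>.\<close>

lemma phi_cong_mod:
  assumes f: "f \<in> face_ring L" and g: "g \<in> face_ring L" and "cong_mod I f g"
  shows "cong_mod J (phi f) (phi g)"
proof -
  have "to_poly f - to_poly g \<in> star_ideal"
    using assms(3) cong_mod_ideal_gen_iff[OF complex_L \<theta>_image_subset f g] ideal_L_subset_star_ideal by blast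
  then have "(to_poly f - to_poly g) - (to_poly f - to_poly (phi f)) + (to_poly g - to_poly (phi g)) \<in> star_ideal"
    using phi_cong[of f] phi_cong[of g] by (metis star_ideal_add star_ideal_diff)
  then show ?thesis by (simp add: cong_mod_J_iff phi_mem algebra_simps)
qed

text \<open>Equality holds exactly, not only modulo \<open>J\<close>: truncation in \<open>L\<close>
  drops nonfaces of \<open>L\<close>, hence of \<open>St\<close>, and elimination turns these into
  nonfaces of \<open>L'\<close>.\<close>

lemma phi_mult:
  assumes "f \<in> face_ring L" and "g \<in> face_ring L"
  shows "phi (fr_mult L f g) = fr_mult L' (phi f) (phi g)"
proof -
  have "to_poly (fr_mult L f g) - to_poly f * to_poly g \<in> nonfaces St"
    unfolding fr_mult_eq_to_face_ring[OF complex_L assms]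
    using to_poly_to_face_ring_diff nonfaces_antimono[OF St_subset_L] by blast
  from subst_elim_nonfaces[OF this]
  have "phi (fr_mult L f g) = to_face_ring L' (subst elim (to_poly f) * subst elim (to_poly g))"
    unfolding phi_def subst_diff subst_mult by (rule to_face_ring_cong)
  then show ?thesis by (simp add: phi_def to_face_ring_mult[OF complex_L'])
qed

lemma phi_nonfaces:
  assumes "to_poly f \<in> nonfaces St"
  shows "phi f = (\<lambda>_. 0)"
  using subst_elim_nonfaces[OF assms] by (simp add: phi_def to_face_ring_eq_zero_iff)

lemma xmon_nonfaces:
  assumes "F \<in> L" and "F \<notin> St"
  shows "to_poly (xmon F) \<in> nonfaces St"
proof -
  have "finite F" by (rule simplicial_complex_finite_face[OF complex_L assms(1)])
  then show ?thesis using assms(2) by (auto simp: to_poly_xmon nonfaces_def lookup_single when_def)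
qed

lemma homog_lin: "homog 1 (lookup (lin a))"
proof -
  have "lookup (lin a) m = 0" if "size m \<noteq> 1" for m
  proof -
    have "lookup (single 0 (M a r) * to_poly (restr L' (\<theta> r))) m = 0" if "r \<in> R" for r
    proof -
      have r: "r < d" using that R_subset by auto
      have "lookup (to_poly (restr L' (\<theta> r))) m = 0"
        using lookup_to_poly[OF restr_\<theta>_mem[OF r L'_subset_L]] \<theta>_homog[OF r] \<open>size m \<noteq> 1\<close>
        by (auto simp: restr_def homog_def)
      then show ?thesis by (simp flip: mult_map_scale_conv_mult add: Poly_Mapping.map.rep_eq when_def)
    qed
    then show ?thesis by (simp add: lin_def lookup_sum)
  qed
  then show ?thesis by (auto simp: homog_def)
qed

text \<open>Elimination replaces variables by linear forms, so each monomial keeps its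
  degree.\<close>

lemma homog_phi:
  assumes f: "f \<in> face_ring L" and hom: "homog j f"
  shows "homog j (phi f)"
proof -
  have elim1: "homog 1 (lookup (elim w))" for w
    using homog_lin by (auto simp: elim_def homog_def lookup_single when_def)
  have prod: "homog (size m) (lookup (\<Prod>w\<in>#m. elim w))" for m
  proof (induction m)
    case empty
    show ?case by (auto simp: homog_def lookup_one when_def)
  next
    case (add w m)
    then show ?case using homog_mult[OF elim1[of w] add] by simp
  qed
  have "lookup (subst elim (to_poly f)) m = 0" if m: "size m \<noteq> j" for m
    unfolding subst_def lookup_sum
  proof (intro sum.neutral ballI)
    fix n assume "n \<in> Poly_Mapping.keys (to_poly f)"
    then have "size n = j" using hom by (auto simp: in_keys_iff lookup_to_poly[OF f] homog_def)
    then have "lookup (\<Prod>w\<in>#n. elim w) m = 0" using prod[of n] m by (auto simp: homog_def)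
    then show "lookup (single 0 (lookup (to_poly f) n) * (\<Prod>w\<in>#n. elim w)) m = 0"
      by (simp flip: mult_map_scale_conv_mult add: Poly_Mapping.map.rep_eq when_def)
  qed
  then show ?thesis by (auto simp: phi_def to_face_ring_def restr_def homog_def)
qed

text \<open>The engine behind the local face modules: elimination turns \<open>x^F\<close> into a
  product of linear forms times \<open>x^(F - A)\<close>, and that monomial is 0 in the link unless
  \<open>F - A\<close> is a face there.\<close>

lemma phi_monomial_ideal:
  assumes p: "p \<in> ideal_gen L {xmon F | F. F \<in> L \<and> P F}"
    and PQ: "\<And>F. F \<in> L \<Longrightarrow> F - A \<in> L' \<Longrightarrow> P F \<Longrightarrow> Q (F - A)"
  shows "phi p \<in> ideal_gen L' {xmon F | F. F \<in> L' \<and> Q F}"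
proof -
  let ?S = "{xmon F | F. F \<in> L \<and> P F} :: ('w multiset \<Rightarrow> 'k) set"
  let ?S' = "{xmon F | F. F \<in> L' \<and> Q F} :: ('w multiset \<Rightarrow> 'k) set"
  have S: "?S \<subseteq> face_ring L" and S': "?S' \<subseteq> face_ring L'"
    using xmon_mem_face_ring simplicial_complex_finite_face complex_L complex_L' by blast+
  have "to_poly p \<in> ideal.span (to_poly ` ?S \<union> nonfaces L)"
    using mem_ideal_gen_iff[OF complex_L S] ideal_gen_subset_face_ring[OF complex_L S] p by blast
  then have "subst elim (to_poly p) \<in> ideal.span (to_poly ` ?S' \<union> nonfaces L')"
  proof (rule subst_mem_ideal)
    fix q :: "'w multiset \<Rightarrow>\<^sub>0 'k" assume "q \<in> to_poly ` ?S \<union> nonfaces L"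
    then show "subst elim q \<in> ideal.span (to_poly ` ?S' \<union> nonfaces L')"
    proof
      assume "q \<in> to_poly ` ?S"
      then obtain F where F: "F \<in> L" "P F" "q = to_poly (xmon F)" by blast
      have fin: "finite F" by (rule simplicial_complex_finite_face[OF complex_L F(1)])
      have "mset_set F = mset_set (F \<inter> A) + mset_set (F - A)"
        using fin by (subst mset_set_Union[symmetric]) (auto intro: arg_cong[where f = mset_set])
      moreover have "image_mset elim (mset_set (F - A)) = image_mset (\<lambda>w. single {#w#} 1) (mset_set (F - A))"
        using fin by (intro image_mset_cong) (auto simp: elim_def)
      ultimately have "subst elim q = (\<Prod>w\<in>#mset_set (F \<inter> A). elim w) * single (mset_set (F - A)) 1"
        unfolding F(3) by (simp add: to_poly_xmon[OF fin] prod_mset_variables)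
      moreover have "single (mset_set (F - A)) 1 \<in> ideal.span (to_poly ` ?S' \<union> nonfaces L')"
      proof (cases "F - A \<in> L'")
        case True
        then have "to_poly (xmon (F - A)) \<in> to_poly ` ?S'" using PQ[OF F(1) _ F(2)] by blast
        then show ?thesis using fin by (intro ideal.span_base) (simp add: to_poly_xmon)
      next
        case False
        then have "single (mset_set (F - A)) 1 \<in> (nonfaces L' :: ('w multiset \<Rightarrow>\<^sub>0 'k) set)"
          using fin by (auto simp: nonfaces_def lookup_single when_def)
        then show ?thesis by (auto intro: ideal.span_base)
      qed
      ultimately show ?thesis by (simp add: ideal.span_scale)
    next
      assume "q \<in> nonfaces L"
      then have "subst elim q \<in> nonfaces L'"
        using subst_elim_nonfaces nonfaces_antimono[OF St_subset_L] by blast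
      then show ?thesis by (auto intro: ideal.span_base)
    qed
  qed
  then show ?thesis unfolding phi_def using to_face_ring_mem_ideal_gen_iff[OF complex_L' S'] by blast
qed

text \<open>\<open>phi\<close> is the identity on \<open>k[L']\<close>, so the images of a finite
  spanning set of the large quotient span the small one.\<close>

lemma phi_finite_quotient:
  assumes lsop: "lsop L \<theta> d"
  shows "\<exists>S. finite S \<and> S \<subseteq> face_ring L' \<and>
    (\<forall>f\<in>face_ring L'. \<exists>c. cong_mod J f (\<lambda>m. \<Sum>s\<in>S. c s * s m))"
proof -
  obtain S where S: "finite S" "S \<subseteq> face_ring L"
    and gen: "\<And>f. f \<in> face_ring L \<Longrightarrow> \<exists>c. cong_mod I f (\<lambda>m. \<Sum>s\<in>S. c s * s m)"
    using lsop by (auto simp: lsop_def)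
  have "\<exists>c. cong_mod J f (\<lambda>m. \<Sum>s\<in>phi ` S. c s * s m)" if f: "f \<in> face_ring L'" for f
  proof -
    have f': "f \<in> face_ring L" using f face_ring_mono[OF L'_subset_L] by blast
    obtain c where c: "cong_mod I f (\<lambda>m. \<Sum>s\<in>S. c s * s m)" using gen[OF f'] by blast
    have mem: "(\<lambda>m. \<Sum>s\<in>S. c s * s m) \<in> face_ring L" using S by (intro face_ring_sum) auto
    have "phi (\<lambda>m. \<Sum>s\<in>S. c s * s m) = (\<lambda>m. \<Sum>s\<in>S. c s * phi s m)"
    proof -
      have "to_poly (\<lambda>m. \<Sum>s\<in>S. c s * s m) = (\<Sum>s\<in>S. single 0 (c s) * to_poly s)"
        using S by (intro to_poly_sum) auto
      then have "subst elim (to_poly (\<lambda>m. \<Sum>s\<in>S. c s * s m)) = (\<Sum>s\<in>S. single 0 (c s) * subst elim (to_poly s))"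
        by (simp add: subst_sum subst_mult)
      then show ?thesis
        by (auto simp: phi_def to_face_ring_def restr_def lookup_sum fun_eq_iff
            simp flip: mult_map_scale_conv_mult intro!: sum.cong)
          (auto simp: Poly_Mapping.map.rep_eq when_def)
    qed
    \<comment> \<open>\<open>phi\<close> may identify elements of \<open>S\<close>, so coefficients
      are collected over its fibres.\<close>
    also have "\<dots> = (\<lambda>m. \<Sum>t\<in>phi ` S. (\<Sum>s\<in>{s\<in>S. phi s = t}. c s) * t m)"
      using S(1) by (auto simp: fun_eq_iff sum_distrib_right intro!: sum.cong
          sum.image_gen[of S "\<lambda>s. c s * phi s _" phi, THEN trans])
    finally have "cong_mod J (phi f) (\<lambda>m. \<Sum>t\<in>phi ` S. (\<Sum>s\<in>{s\<in>S. phi s = t}. c s) * t m)"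
      using phi_cong_mod[OF f' mem c] by simp
    then show ?thesis unfolding phi_id[OF f]
      by (intro exI[of _ "\<lambda>t. \<Sum>s\<in>{s\<in>S. phi s = t}. c s"])
  qed
  then show ?thesis using S phi_mem by (intro exI[of _ "phi ` S"]) auto
qed

text \<open>Write \<open>f - phi f\<close> as an element of the ideal of the
  \<open>\<theta> i\<close> plus nonfaces of the star. Modulo \<open>J\<close>, a competing
  \<open>\<psi>\<close> ignores the former, kills the latter and fixes \<open>phi f\<close>.\<close>

lemma phi_unique:
  fixes \<psi> :: "('w multiset \<Rightarrow> 'k) \<Rightarrow> 'w multiset \<Rightarrow> 'k"
  assumes maps: "\<And>p. p \<in> face_ring L \<Longrightarrow> \<psi> p \<in> face_ring L'"
    and cong: "\<And>p q. p \<in> face_ring L \<Longrightarrow> q \<in> face_ring L \<Longrightarrow> cong_mod I p q \<Longrightarrow> cong_mod J (\<psi> p) (\<psi> q)"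
    and add: "\<And>p q. p \<in> face_ring L \<Longrightarrow> q \<in> face_ring L \<Longrightarrow> cong_mod J (\<psi> (fr_add p q)) (fr_add (\<psi> p) (\<psi> q))"
    and mult: "\<And>p q. p \<in> face_ring L \<Longrightarrow> q \<in> face_ring L \<Longrightarrow>
      cong_mod J (\<psi> (fr_mult L p q)) (fr_mult L' (\<psi> p) (\<psi> q))"
    and id: "\<And>r. r \<in> face_ring L' \<Longrightarrow> cong_mod J (\<psi> r) r"
    and kill: "\<And>F. F \<in> L \<Longrightarrow> F \<notin> St \<Longrightarrow> cong_mod J (\<psi> (xmon F)) (\<lambda>_. 0)"
    and f: "f \<in> face_ring L"
  shows "cong_mod J (phi f) (\<psi> f)"
proof -
  have to_poly_zero: "to_poly (\<lambda>_. 0) = (0 :: 'w multiset \<Rightarrow>\<^sub>0 'k)" by (simp add: to_poly_def)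
  have LL: "r \<in> face_ring L" if "r \<in> face_ring L'" for r :: "'w multiset \<Rightarrow> 'k"
    using that face_ring_mono[OF L'_subset_L] by blast
  have trans: "to_poly p \<in> star_ideal" if "to_poly p - q \<in> star_ideal" "q \<in> star_ideal" for p q
    using ideal.span_add[OF that[unfolded star_ideal_def]] by (simp add: star_ideal_def)
  have add': "to_poly (\<psi> (\<lambda>m. p m + q m)) - (to_poly (\<psi> p) + to_poly (\<psi> q)) \<in> star_ideal"
    if p: "p \<in> face_ring L" and q: "q \<in> face_ring L" for p q
    using add[OF p q] maps[OF p] maps[OF q] maps[OF face_ring_add[OF p q]]
    by (simp add: fr_add_def cong_mod_J_iff face_ring_add to_poly_add)
  \<comment> \<open>Membership in \<open>k[L]\<close> is part of the claim because additivity of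
    \<open>\<psi>\<close> is available only for summands in \<open>k[L]\<close>.\<close>
  have off_star: "lookup p \<in> face_ring L \<and> to_poly (\<psi> (lookup p)) \<in> star_ideal"
    if p: "p \<in> nonfaces St" "lookup p \<in> face_ring L" for p
  proof (induction p rule: poly_mapping_sum_induct)
    case zero
    have "lookup (0 :: 'w multiset \<Rightarrow>\<^sub>0 'k) = (\<lambda>_. 0)" by auto
    then show ?case using id[OF face_ring_zero] maps[OF face_ring_zero]
      by (simp add: cong_mod_J_iff to_poly_zero face_ring_zero)
  next
    case (single m c)
    then have m: "set_mset m \<in> L" "set_mset m \<notin> St"
      using p by (auto simp: nonfaces_def face_ring_def in_keys_iff)
    \<comment> \<open>Only squarefree monomials are killed by assumption, so the term is split as a
      cofactor times \<open>x^F\<close>; the cofactor absorbs the scalar \<open>c\<close>.\<close>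
    let ?F = "set_mset m"
    let ?q = "single (m - mset_set ?F) c"
    have xF: "xmon ?F \<in> face_ring L" using m by (simp add: xmon_mem_face_ring)
    have mem: "lookup (single n c) \<in> face_ring L" if "n \<subseteq># m" for n
      using simplicial_complex_subset[OF complex_L m(1) set_mset_mono[OF that]]
      by (auto simp: face_ring_def lookup_single when_def)
    have q: "lookup ?q \<in> face_ring L" by (intro mem) simp
    have "fr_mult L (lookup ?q) (xmon ?F) = to_face_ring L (?q * single (mset_set ?F) 1)"
      unfolding fr_mult_eq_to_face_ring[OF complex_L q xF] by (simp add: to_poly_xmon to_poly_lookup)
    also have "?q * single (mset_set ?F) 1 = single m c"
      using mset_set_set_mset_msubset[of m] by (simp add: mult_single)
    also have "to_face_ring L (single m c) = lookup (single m c)"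
      using m by (auto simp: to_face_ring_def restr_def lookup_single when_def)
    finally have eq: "lookup (single m c) = fr_mult L (lookup ?q) (xmon ?F)" by simp
    have "to_poly (\<psi> (xmon ?F)) \<in> star_ideal"
      using kill[OF m] maps[OF xF] by (simp add: cong_mod_J_iff face_ring_zero to_poly_zero)
    then have "to_poly (fr_mult L' (\<psi> (lookup ?q)) (\<psi> (xmon ?F))) \<in> star_ideal"
      by (intro fr_mult_L'_star_ideal maps q xF)
    moreover have "to_poly (\<psi> (lookup (single m c))) - to_poly (fr_mult L' (\<psi> (lookup ?q)) (\<psi> (xmon ?F))) \<in> star_ideal"
      unfolding eq using mult[OF q xF] maps[OF q] maps[OF xF] maps[OF mem[of m, unfolded eq]]
      by (simp add: cong_mod_J_iff fr_mult_L'_mem)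
    ultimately show ?case using mem[of m] trans by blast
  next
    case (add p q)
    have eq: "lookup (p + q) = (\<lambda>m. lookup p m + lookup q m)" by (auto simp: lookup_add)
    have "to_poly (\<psi> (lookup p)) + to_poly (\<psi> (lookup q)) \<in> star_ideal"
      using add unfolding star_ideal_def by (intro ideal.span_add) auto
    then show ?case unfolding eq using add add'[of "lookup p" "lookup q"] trans
      by (blast intro: face_ring_add)
  qed
  \<comment> \<open>Since \<open>nonfaces St\<close> is an ideal and thus its own span,
    \<open>star_ideal\<close> splits as a sum with it as one summand.\<close>
  have sub: "ideal.subspace (nonfaces St :: ('w multiset \<Rightarrow>\<^sub>0 'k) set)"
    unfolding ideal.subspace_def using nonfaces_add nonfaces_mult[OF complex_St]
    by (auto simp: nonfaces_def[of St, THEN eqset_imp_iff, of 0, THEN iffD2])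
  obtain x y where xy: "to_poly f - to_poly (phi f) = x + y" "x \<in> ideal.span (to_poly ` \<theta> ` {..<d})" "y \<in> nonfaces St"
    using phi_cong[of f] sub unfolding star_ideal_def ideal.span_Un ideal.span_eq_iff[THEN iffD2, OF sub] by blast
  \<comment> \<open>\<open>y\<close> need not live in \<open>k[L]\<close>; its truncation does,
    stays off the star, and differs from \<open>y\<close> only by nonfaces of
    \<open>L\<close>.\<close>
  let ?n = "to_face_ring L y"
  have n: "?n \<in> face_ring L" by (rule to_face_ring_mem)
  have "to_poly ?n \<in> nonfaces St"
    using xy(3) unfolding nonfaces_def mem_Collect_eq lookup_to_poly_to_face_ring restr_def by auto
  from off_star[OF this] have \<psi>n: "to_poly (\<psi> ?n) \<in> star_ideal" using n by (simp add: lookup_to_poly)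
  let ?g = "\<lambda>m. phi f m + ?n m"
  have pf: "phi f \<in> face_ring L" by (rule LL[OF phi_mem])
  have g: "?g \<in> face_ring L" by (rule face_ring_add[OF pf n])
  have "to_poly f - to_poly ?g = x - (to_poly ?n - y)"
    unfolding to_poly_add[OF pf n] using xy(1) by (simp add: algebra_simps)
  moreover have "x \<in> ideal.span (to_poly ` \<theta> ` {..<d} \<union> nonfaces L)"
    using xy(2) ideal.span_mono[of "to_poly ` \<theta> ` {..<d}" "to_poly ` \<theta> ` {..<d} \<union> nonfaces L"] by blast
  moreover have "to_poly ?n - y \<in> ideal.span (to_poly ` \<theta> ` {..<d} \<union> nonfaces L)"
    by (intro ideal.span_base) (simp add: to_poly_to_face_ring_diff)
  ultimately have "cong_mod I f ?g"
    unfolding cong_mod_ideal_gen_iff[OF complex_L \<theta>_image_subset f g] using ideal.span_diff by metis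
  from cong[OF f g this] have 1: "to_poly (\<psi> f) - to_poly (\<psi> ?g) \<in> star_ideal"
    using maps[OF f] maps[OF g] by (simp add: cong_mod_J_iff)
  have 2: "to_poly (\<psi> ?g) - (to_poly (\<psi> (phi f)) + to_poly (\<psi> ?n)) \<in> star_ideal" by (rule add'[OF pf n])
  have 3: "to_poly (\<psi> (phi f)) - to_poly (phi f) \<in> star_ideal"
    using id[OF phi_mem[of f]] maps[OF pf] by (simp add: cong_mod_J_iff phi_mem)
  have "- (((to_poly (\<psi> f) - to_poly (\<psi> ?g)) + (to_poly (\<psi> ?g) - (to_poly (\<psi> (phi f)) + to_poly (\<psi> ?n))))
      + ((to_poly (\<psi> (phi f)) - to_poly (phi f)) + to_poly (\<psi> ?n))) \<in> star_ideal"
    using 1 2 3 \<psi>n unfolding star_ideal_def by (intro ideal.span_neg ideal.span_add)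
  then have "to_poly (phi f) - to_poly (\<psi> f) \<in> star_ideal" by (simp add: algebra_simps)
  then show ?thesis using maps[OF f] by (simp add: cong_mod_J_iff phi_mem)
qed

end

section \<open>Homology triangulations\<close>

text \<open>On a face with \<open>d\<close> vertices the coefficient matrix is square and
  invertible, so no two of its rows coincide.\<close>

lemma lsop_distinct:
  fixes \<zeta> :: "nat \<Rightarrow> 'w multiset \<Rightarrow> 'k::field"
  assumes \<Delta>: "simplicial_complex \<Delta>" and lsop: "lsop \<Delta> \<zeta> d" and F: "F \<in> \<Delta>" "card F = d"
    and ij: "i < d" "j < d" "i \<noteq> j"
  shows "\<zeta> i \<noteq> \<zeta> j"
proof
  assume eq: "\<zeta> i = \<zeta> j"
  have "\<exists>R M. R \<subseteq> {..<d} \<and> card R = card F \<and>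
    (\<forall>a\<in>F. \<forall>b\<in>F. (\<Sum>r\<in>R. M a r * \<zeta> r {#b#}) = (if a = b then 1 else 0)) \<and>
    (\<forall>r\<in>R. \<forall>r'\<in>R. (\<Sum>a\<in>F. \<zeta> r {#a#} * M a r') = (if r = r' then 1 else 0))"
    using simplicial_complex_finite_face[OF \<Delta> F(1)] lsop_trivial_kernel[OF \<Delta> lsop F(1)]
    by (intro trivial_kernel_imp_inverse) auto
  then obtain R M where R: "R \<subseteq> {..<d}" "card R = d"
    and inv: "\<And>r r'. r \<in> R \<Longrightarrow> r' \<in> R \<Longrightarrow> (\<Sum>a\<in>F. \<zeta> r {#a#} * M a r') = (if r = r' then 1 else 0)"
    using F(2) by blast
  have "R = {..<d}" using R by (intro card_subset_eq) auto
  then have "(\<Sum>a\<in>F. \<zeta> i {#a#} * M a i) = 1" "(\<Sum>a\<in>F. \<zeta> j {#a#} * M a i) = 0"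
    using inv ij by auto
  then show False by (simp add: eq)
qed

text \<open>Supplies the reordering: the forms assigned to elements outside the carrier of
  \<open>E'\<close> come at the beginning, the eliminated rows at the end.\<close>

lemma ex_bij_prefix_suffix:
  assumes B: "B \<subseteq> {..<d}" and R: "R \<subseteq> {..<d}" and disj: "B \<inter> R = {}"
  shows "\<exists>\<pi>. bij_betw \<pi> {..<d} {..<d} \<and> \<pi> ` {..<card B} = B \<and> \<pi> ` {d - card R..<d} = (R :: nat set)"
proof -
  have fin: "finite B" "finite R" using B R finite_subset by blast+
  have le: "card B + card R \<le> d"
    using card_mono[of "{..<d}" "B \<union> R"] B R card_Un_disjoint[OF fin disj] by simp
  let ?C = "{..<d} - (B \<union> R)"
  have "card ?C = d - (card B + card R)"
    using B R fin card_Un_disjoint[OF fin disj] by (subst card_Diff_subset) auto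
  then have "card {card B..<d - card R} = card ?C" by simp
  then obtain h2 where h2: "bij_betw h2 {card B..<d - card R} ?C"
    using finite_same_card_bij[of "{card B..<d - card R}" ?C] by auto
  obtain h1 where h1: "bij_betw h1 {..<card B} B"
    using finite_same_card_bij[of "{..<card B}" B] fin by auto
  obtain h3 where h3: "bij_betw h3 {d - card R..<d} R"
    using finite_same_card_bij[of "{d - card R..<d}" R] fin le by auto
  define \<pi> where "\<pi> i = (if i < card B then h1 i else if i < d - card R then h2 i else h3 i)" for i
  have 1: "bij_betw \<pi> {..<card B} B"
    using h1 by (rule iffD1[OF bij_betw_cong, rotated]) (auto simp: \<pi>_def)
  have 2: "bij_betw \<pi> {card B..<d - card R} ?C"
    using h2 by (rule iffD1[OF bij_betw_cong, rotated]) (auto simp: \<pi>_def)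
  have 3: "bij_betw \<pi> {d - card R..<d} R"
    using h3 by (rule iffD1[OF bij_betw_cong, rotated]) (use le in \<open>auto simp: \<pi>_def\<close>)
  have "bij_betw \<pi> ({..<card B} \<union> {card B..<d - card R} \<union> {d - card R..<d}) (B \<union> ?C \<union> R)"
    using disj by (intro bij_betw_combine 1 2 3) auto
  moreover have "{..<card B} \<union> {card B..<d - card R} \<union> {d - card R..<d} = {..<d}" using le by auto
  moreover have "B \<union> ?C \<union> R = {..<d}" using B R by auto
  ultimately show ?thesis using 1 3 by (auto simp: bij_betw_def)
qed

lemma hball_complex: "hball K d \<Gamma> B \<Longrightarrow> simplicial_complex \<Gamma> \<and> cdim \<Gamma> = d \<and> simplicial_complex B"
  by (auto elim: hball.cases simp: homology_sphere_def)

text \<open>The faces with carrier inside a given nonempty set form a ball, in particular a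
  subcomplex.\<close>

lemma carrier_mono:
  assumes tri: "homology_triangulation K \<Gamma> \<sigma> V" and F: "F \<in> \<Gamma>" and GF: "G \<subseteq> F"
  shows "\<sigma> G \<subseteq> \<sigma> F"
proof -
  have \<Gamma>: "simplicial_complex \<Gamma>" and \<sigma>V: "\<And>F. F \<in> \<Gamma> \<Longrightarrow> \<sigma> F \<subseteq> V"
    and ball: "\<And>U. U \<subseteq> V \<Longrightarrow> U \<noteq> {} \<Longrightarrow> \<exists>B. hball K (int (card U) - 1) (restrict_tri \<Gamma> \<sigma> U) B \<and>
             restrict_tri \<Gamma> \<sigma> U - B = {F \<in> \<Gamma>. \<sigma> F = U}"
    using tri unfolding homology_triangulation_def by blast+
  have G: "G \<in> \<Gamma>" by (rule simplicial_complex_subset[OF \<Gamma> F GF])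
  show ?thesis
  proof (cases "\<sigma> F = {}")
    case False
    then have "simplicial_complex (restrict_tri \<Gamma> \<sigma> (\<sigma> F))"
      using ball[OF \<sigma>V[OF F]] hball_complex by blast
    then have "G \<in> restrict_tri \<Gamma> \<sigma> (\<sigma> F)"
      by (rule simplicial_complex_subset[OF _ _ GF]) (simp add: restrict_tri_def F)
    then show ?thesis by (simp add: restrict_tri_def)
  next
    \<comment> \<open>No ball is given over the empty set. For \<open>v \<in> V\<close>, a face with
      empty carrier lies in the boundary of the ball over \<open>{v}\<close>; that boundary is
      closed under subsets, and its faces have carrier properly inside \<open>{v}\<close>.\<close>
    case True
    show ?thesis
    proof (cases "V = {}")
      case True
      then show ?thesis using \<sigma>V[OF G] by simp
    next
      case False
      then obtain v where v: "v \<in> V" by blast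
      then obtain B where B: "hball K (int (card {v}) - 1) (restrict_tri \<Gamma> \<sigma> {v}) B"
        "restrict_tri \<Gamma> \<sigma> {v} - B = {F \<in> \<Gamma>. \<sigma> F = {v}}"
        using ball[of "{v}"] by blast
      have "F \<in> restrict_tri \<Gamma> \<sigma> {v}" using F True by (simp add: restrict_tri_def)
      then have FB: "F \<in> B" using B(2) True by blast
      have "simplicial_complex B" "simplicial_complex (restrict_tri \<Gamma> \<sigma> {v})" using hball_complex[OF B(1)] by auto
      then have "G \<in> B" "G \<in> restrict_tri \<Gamma> \<sigma> {v}"
        using FB \<open>F \<in> restrict_tri \<Gamma> \<sigma> {v}\<close> simplicial_complex_subset GF by blast+
      then have "\<sigma> G \<subseteq> {v}" "\<sigma> G \<noteq> {v}" using B(2) G by (auto simp: restrict_tri_def)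
      then show ?thesis by blast
    qed
  qed
qed

text \<open>One inversion suffices: a face is interior, or empty, or a nonempty boundary face, and
  the definition prescribes the dimension of the link in each case.\<close>

lemma cdim_link_hball:
  assumes "hball K d \<Gamma> B" and E: "E \<in> \<Gamma>"
  shows "cdim (link \<Gamma> E) = d - int (card E)"
  using assms(1)
proof (rule hball.cases)
  fix \<Gamma>' d' B'
  assume eq: "d = d'" "\<Gamma> = \<Gamma>'" "B = B'" and dim: "cdim \<Gamma>' = d'"
    and sphere: "\<forall>F\<in>\<Gamma>' - B'. homology_sphere K (link \<Gamma>' F) (d' - int (card F))"
    and ball: "\<forall>F\<in>B'. F \<noteq> {} \<longrightarrow> (\<exists>B''. hball K (d' - int (card F)) (link \<Gamma>' F) B'')"
  show ?thesis
  proof (cases "E \<in> B'")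
    case False
    then have "homology_sphere K (link \<Gamma> E) (d - int (card E))" using sphere E eq by simp
    then show ?thesis by (simp add: homology_sphere_def)
  next
    case True
    show ?thesis
    proof (cases "E = {}")
      case True
      then show ?thesis using dim eq by (simp add: link_def)
    next
      case False
      then obtain B'' where "hball K (d' - int (card E)) (link \<Gamma>' E) B''" using ball True by blast
      then show ?thesis using hball_complex eq by blast
    qed
  qed
qed

lemma ex_face_link_card:
  assumes tri: "homology_triangulation K \<Gamma> \<sigma> V" and E: "E \<in> \<Gamma>"
  shows "\<exists>F\<in>link \<Gamma> E. card F = card V - card E"
proof -
  have \<Gamma>: "simplicial_complex \<Gamma>" using tri by (simp add: homology_triangulation_def)
  note link = simplicial_complex_link[OF \<Gamma> E]
  then have ne: "link \<Gamma> E \<noteq> {}" "finite (link \<Gamma> E)" and empty: "{} \<in> link \<Gamma> E"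
    by (auto simp: simplicial_complex_def)
  show ?thesis
  proof (cases "V = {}")
    \<comment> \<open>No ball is attached to the empty set; here the natural-number difference is 0
      and the empty face serves.\<close>
    case True
    then show ?thesis using empty by force
  next
    case False
    have "restrict_tri \<Gamma> \<sigma> V = \<Gamma>"
      using tri by (auto simp: restrict_tri_def homology_triangulation_def)
    then obtain B where "hball K (int (card V) - 1) \<Gamma> B"
      using tri False unfolding homology_triangulation_def by (metis order_refl)
    then have "cdim (link \<Gamma> E) = int (card V) - 1 - int (card E)" using E by (rule cdim_link_hball)
    then have "Max (card ` link \<Gamma> E) = card V - card E" by (simp add: cdim_def)
    moreover have "Max (card ` link \<Gamma> E) \<in> card ` link \<Gamma> E" using ne by (intro Max_in) auto
    ultimately show ?thesis by auto
  qed
qed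

theorem theorem1p4:
  fixes \<Gamma> :: "'w::linorder set set" and \<sigma> :: "'w set \<Rightarrow> 'v set" and V :: "'v set"
    and E E' :: "'w set" and \<theta> :: "nat \<Rightarrow> 'w multiset \<Rightarrow> 'k::field"
  assumes "infinite (UNIV :: 'k set)"
    and "homology_triangulation TYPE('k) \<Gamma> \<sigma> V"
    and "quasi_geometric \<Gamma> \<sigma> V"
    and "E \<in> \<Gamma>" and "E' \<in> \<Gamma>" and "E \<subseteq> E'"
    and "special_lsop \<Gamma> \<sigma> V E \<theta>"
  shows "\<exists>\<phi>. is_phi \<Gamma> E E' \<theta> (card V - card E) \<phi> \<and>
           (\<forall>\<psi>. is_phi \<Gamma> E E' \<theta> (card V - card E) \<psi> \<longrightarrow>
              (\<forall>p\<in>face_ring (link \<Gamma> E).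
                 cong_mod (Jideal \<Gamma> E E' \<theta> (card V - card E)) (\<phi> p) (\<psi> p))) \<and>
           (\<exists>\<zeta>. special_lsop \<Gamma> \<sigma> V E' \<zeta> \<and>
              ideal_gen (link \<Gamma> E') (\<zeta> ` {..<card V - card E'}) = Jideal \<Gamma> E E' \<theta> (card V - card E) \<and>
              (\<exists>\<pi>. bij_betw \<pi> {..<card V - card E} {..<card V - card E} \<and>
                   (\<forall>i<card V - card (\<sigma> E'). restr (link \<Gamma> E') (\<theta> (\<pi> i)) = \<zeta> i)) \<and>
              (\<forall>p\<in>int_ideal \<Gamma> \<sigma> V E. \<exists>q\<in>int_ideal \<Gamma> \<sigma> V E'.
                 cong_mod (ideal_gen (link \<Gamma> E') (\<zeta> ` {..<card V - card E'})) (\<phi> p) q))"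
proof -
  let ?d = "card V - card E" and ?d' = "card V - card E'" and ?b = "card V - card (\<sigma> E')"
  let ?L = "link \<Gamma> E" and ?A = "E' - E"
  note tri = assms(2) and E = assms(4) and E' = assms(5) and EE' = assms(6)
  have \<Gamma>: "simplicial_complex \<Gamma>" and finV: "finite V" and \<sigma>V: "\<And>F. F \<in> \<Gamma> \<Longrightarrow> \<sigma> F \<subseteq> V"
    using tri unfolding homology_triangulation_def by blast+
  have L: "simplicial_complex ?L" by (rule simplicial_complex_link[OF \<Gamma> E])
  have "E' - E \<union> E = E'" using EE' by blast
  then have A: "?A \<in> ?L" using simplicial_complex_subset[OF \<Gamma> E', of ?A] E' by (auto simp: link_def)
  have link': "link \<Gamma> E' = link ?L ?A" using link_link[OF \<Gamma> EE'] by simp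
  obtain f where lsop: "lsop ?L \<theta> ?d"
    and f: "\<And>v. v \<in> V - \<sigma> E \<Longrightarrow> f v < ?d"
      "\<And>v. v \<in> V - \<sigma> E \<Longrightarrow> supp1 (\<theta> (f v)) \<subseteq> {w \<in> vertices ?L. v \<in> \<sigma> {w}}"
      "\<And>v v'. v \<in> V - \<sigma> E \<Longrightarrow> v' \<in> V - \<sigma> E \<Longrightarrow> v \<noteq> v' \<Longrightarrow> \<theta> (f v) \<noteq> \<theta> (f v')"
    using assms(7) unfolding special_lsop_def by blast
  have "\<exists>R M. R \<subseteq> {..<?d} \<and> card R = card ?A \<and>
    (\<forall>a\<in>?A. \<forall>b\<in>?A. (\<Sum>r\<in>R. M a r * \<theta> r {#b#}) = (if a = b then 1 else 0)) \<and>
    (\<forall>r\<in>R. \<forall>r'\<in>R. (\<Sum>a\<in>?A. \<theta> r {#a#} * M a r') = (if r = r' then 1 else 0))"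
    using simplicial_complex_finite_face[OF L A] lsop_trivial_kernel[OF L lsop A]
    by (intro trivial_kernel_imp_inverse) auto
  then obtain R M where R: "R \<subseteq> {..<?d}" "card R = card ?A"
    and left: "\<And>a b. a \<in> ?A \<Longrightarrow> b \<in> ?A \<Longrightarrow> (\<Sum>r\<in>R. M a r * \<theta> r {#b#}) = (if a = b then 1 else 0)"
    and right: "\<And>r r'. r \<in> R \<Longrightarrow> r' \<in> R \<Longrightarrow> (\<Sum>a\<in>?A. \<theta> r {#a#} * M a r') = (if r = r' then 1 else 0)"
    by blast
  interpret link_projection ?L ?A \<theta> ?d R M
    by unfold_locales (use L A R left right lsop in \<open>auto simp: lsop_def\<close>)
  have Jideal: "Jideal \<Gamma> E E' \<theta> ?d = J"
    by (simp add: Jideal_def Let_def link')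

  \<comment> \<open>An element outside the carrier of \<open>E'\<close> is outside that of
    \<open>E\<close>, so \<open>f\<close> already assigns it a form.\<close>
  have sub: "V - \<sigma> E' \<subseteq> V - \<sigma> E" using carrier_mono[OF tri E' EE'] by blast
  define B where "B = f ` (V - \<sigma> E')"
  have inj: "inj_on f (V - \<sigma> E')" using f(3) sub by (intro inj_onI) (metis subsetD)
  have B_d: "B \<subseteq> {..<?d}" using f(1) sub by (auto simp: B_def)
  have cardB: "card B = ?b"
    unfolding B_def card_image[OF inj] using \<sigma>V[OF E'] finV by (intro card_Diff_subset) (auto intro: finite_subset)
  have zero_A: "\<theta> i {#a#} = 0" if i: "i \<in> B" and a: "a \<in> ?A" for i a
  proof (rule ccontr)
    assume nz: "\<theta> i {#a#} \<noteq> 0"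
    obtain v where v: "v \<in> V - \<sigma> E'" "i = f v" using i by (auto simp: B_def)
    then have "v \<in> \<sigma> {a}" using f(2)[of v] sub nz by (auto simp: supp1_def)
    moreover have "\<sigma> {a} \<subseteq> \<sigma> E'" using a by (intro carrier_mono[OF tri E']) auto
    ultimately show False using v by blast
  qed
  have disj: "B \<inter> R = {}"
  proof (rule ccontr)
    assume "B \<inter> R \<noteq> {}"
    then obtain r where r: "r \<in> B" "r \<in> R" by blast
    \<comment> \<open>A row that is zero on \<open>A\<close> cannot produce the diagonal entry 1 of
      the inverse relation.\<close>
    have "(\<Sum>a\<in>?A. \<theta> r {#a#} * M a r) = 0" by (intro sum.neutral) (simp add: zero_A[OF r(1)])
    then show False using right[OF r(2) r(2)] by simp
  qed
  have d': "?d - card R = ?d'"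
    using R(2) card_Diff_subset[OF simplicial_complex_finite_face[OF \<Gamma> E] EE']
      card_mono[OF simplicial_complex_finite_face[OF \<Gamma> E'] EE'] by simp
  have b_le: "?b \<le> ?d'"
  proof -
    have fin: "finite B" "finite R" using B_d R(1) finite_subset by blast+
    have "card (B \<union> R) \<le> ?d" using B_d R(1) card_mono[of "{..<?d}" "B \<union> R"] by simp
    then show ?thesis using card_Un_disjoint[OF fin disj] cardB d' by linarith
  qed
  obtain \<pi> where \<pi>: "bij_betw \<pi> {..<?d} {..<?d}" "\<pi> ` {..<?b} = B" "\<pi> ` {?d'..<?d} = R"
    using ex_bij_prefix_suffix[OF B_d R(1) disj] unfolding cardB d' by blast
  \<comment> \<open>The first d' of these are the new system; the remaining ones, coming from
    \<open>R\<close>, vanish.\<close>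
  define \<zeta> where "\<zeta> i = phi (\<theta> (\<pi> i))" for i
  have d'_le: "?d' \<le> ?d" using d' by linarith
  have \<pi>_lt: "\<pi> i < ?d" if "i < ?d" for i using \<pi>(1) that by (auto simp: bij_betw_def)
  have \<zeta>_b: "\<zeta> i = restr (link \<Gamma> E') (\<theta> (\<pi> i))" if "i < ?b" for i
  proof -
    have "\<pi> i \<in> B" using that \<pi>(2) by blast
    then show ?thesis unfolding \<zeta>_def link' using B_d zero_A by (intro phi_\<theta>_zero_on_A) auto
  qed
  have ideal: "ideal_gen L' (\<zeta> ` {..<?d'}) = J"
    unfolding J_eq
  proof (rule ideal_gen_remove_zero[OF complex_L'])
    show "(\<lambda>i. phi (\<theta> i)) ` {..<?d} \<subseteq> face_ring L'" using phi_mem by auto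
    show "\<zeta> ` {..<?d'} \<subseteq> (\<lambda>i. phi (\<theta> i)) ` {..<?d}" using \<pi>_lt d'_le by (fastforce simp: \<zeta>_def)
    show "(\<lambda>i. phi (\<theta> i)) ` {..<?d} \<subseteq> insert (\<lambda>_. 0) (\<zeta> ` {..<?d'})"
    proof (intro image_subsetI)
      fix i assume "i \<in> {..<?d}"
      then obtain j where j: "j < ?d" "i = \<pi> j" using \<pi>(1) by (auto simp: bij_betw_def image_iff)
      show "phi (\<theta> i) \<in> insert (\<lambda>_. 0) (\<zeta> ` {..<?d'})"
      proof (cases "j < ?d'")
        case True
        then show ?thesis by (auto simp: j \<zeta>_def)
      next
        case False
        then have "i \<in> R" using j \<pi>(3) by auto
        then show ?thesis using phi_\<theta>_R by simp
      qed
    qed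
  qed
  have lsop': "lsop (link \<Gamma> E') \<zeta> ?d'"
    unfolding lsop_def link' ideal
    using phi_mem \<theta>_face_ring \<theta>_homog homog_phi \<pi>_lt d'_le phi_finite_quotient[OF lsop]
    by (auto simp: \<zeta>_def)
  obtain F where F: "F \<in> link \<Gamma> E'" "card F = ?d'" using ex_face_link_card[OF tri E'] by blast
  have special: "special_lsop \<Gamma> \<sigma> V E' \<zeta>"
  proof -
    \<comment> \<open>The position of the form for \<open>v\<close> in the new order; it is below
      \<open>?b\<close>, where \<open>\<zeta>\<close> is a plain restriction.\<close>
    define g where "g v = inv_into {..<?b} \<pi> (f v)" for v
    have g: "g v < ?b" "\<pi> (g v) = f v" if "v \<in> V - \<sigma> E'" for v
    proof -
      have "f v \<in> \<pi> ` {..<?b}" using that \<pi>(2) by (auto simp: B_def)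
      then show "g v < ?b" "\<pi> (g v) = f v"
        unfolding g_def using inv_into_into[of "f v" \<pi> "{..<?b}"] by (auto simp: f_inv_into_f)
    qed
    have "g v < ?d' \<and> supp1 (\<zeta> (g v)) \<subseteq> {w \<in> vertices (link \<Gamma> E'). v \<in> \<sigma> {w}} \<and>
        (\<forall>v'\<in>V - \<sigma> E'. v \<noteq> v' \<longrightarrow> \<zeta> (g v) \<noteq> \<zeta> (g v'))" if v: "v \<in> V - \<sigma> E'" for v
    proof (intro conjI ballI impI)
      show lt: "g v < ?d'" using g(1)[OF v] b_le by linarith
      have "supp1 (\<theta> (f v)) \<subseteq> {w. v \<in> \<sigma> {w}}" using f(2)[of v] v sub by blast
      then show "supp1 (\<zeta> (g v)) \<subseteq> {w \<in> vertices (link \<Gamma> E'). v \<in> \<sigma> {w}}"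
        unfolding \<zeta>_b[OF g(1)[OF v]] g(2)[OF v] by (auto simp: supp1_def restr_def vertices_def split: if_splits)
      fix v' assume v': "v' \<in> V - \<sigma> E'" "v \<noteq> v'"
      have "g v' < ?d'" using g(1)[OF v'(1)] b_le by linarith
      moreover have "g v \<noteq> g v'" using g(2)[OF v] g(2)[OF v'(1)] inj_onD[OF inj _ v v'(1)] v'(2) by metis
      \<comment> \<open>Distinct forms could become equal after restriction, so distinctness is
        obtained anew from the parameter property.\<close>
      ultimately show "\<zeta> (g v) \<noteq> \<zeta> (g v')"
        using lsop_distinct[OF _ lsop' F lt] complex_L' link' by simp
    qed
    then show ?thesis unfolding special_lsop_def using lsop' by blast
  qed

  have is_phi: "is_phi \<Gamma> E E' \<theta> ?d phi"
    unfolding is_phi_def Let_def Jideal link'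
  proof (intro conjI ballI allI impI)
    fix p :: "'w multiset \<Rightarrow> 'k" assume p: "p \<in> face_ring ?L"
    show "phi p \<in> face_ring L'" by (rule phi_mem)
    show "\<exists>q\<in>face_ring L'. homog j q \<and> cong_mod J (phi p) q" if "homog j p" for j
      using homog_phi[OF p that] phi_mem cong_mod_J_refl by blast
    fix q :: "'w multiset \<Rightarrow> 'k" assume q: "q \<in> face_ring ?L"
    show "cong_mod J (phi p) (phi q)" if "cong_mod I p q" by (rule phi_cong_mod[OF p q that])
    show "cong_mod J (phi (fr_add p q)) (fr_add (phi p) (phi q))"
      unfolding fr_add_def phi_add[OF p q] by (intro cong_mod_J_refl face_ring_add phi_mem)
    show "cong_mod J (phi (fr_mult ?L p q)) (fr_mult L' (phi p) (phi q))"
      unfolding phi_mult[OF p q] by (intro cong_mod_J_refl fr_mult_L'_mem phi_mem)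
  next
    fix r :: "'w multiset \<Rightarrow> 'k" assume "r \<in> face_ring L'"
    then show "cong_mod J (phi r) r" by (simp only: phi_id cong_mod_J_refl)
  next
    fix F assume "F \<in> ?L" "F \<notin> St"
    then have "phi (xmon F) = (\<lambda>_. 0)" by (intro phi_nonfaces xmon_nonfaces)
    then show "cong_mod J (phi (xmon F)) (\<lambda>_. 0)" by (simp only: cong_mod_J_refl face_ring_zero)
  qed
  have unique: "cong_mod J (phi p) (\<psi> p)" if \<psi>: "is_phi \<Gamma> E E' \<theta> ?d \<psi>" and p: "p \<in> face_ring ?L" for \<psi> p
    using \<psi> unfolding is_phi_def Let_def Jideal link' by (intro phi_unique[OF _ _ _ _ _ _ p]) blast+
  have int: "phi p \<in> int_ideal \<Gamma> \<sigma> V E'" if "p \<in> int_ideal \<Gamma> \<sigma> V E" for p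
    using that unfolding int_ideal_def link'
  proof (rule phi_monomial_ideal)
    fix F assume F: "F \<in> ?L" "F - ?A \<in> L'" "\<sigma> (F \<union> E) = V"
    have face: "(F - ?A) \<union> E' \<in> \<Gamma>" using F(2) unfolding link'[symmetric] by (simp add: link_def)
    \<comment> \<open>\<open>F \<union> E\<close> is contained in
      \<open>(F - ?A) \<union> E'\<close>, so monotone carriers keep the face interior.\<close>
    have "\<sigma> (F \<union> E) \<subseteq> \<sigma> ((F - ?A) \<union> E')" using EE' by (intro carrier_mono[OF tri face]) auto
    then show "\<sigma> ((F - ?A) \<union> E') = V" using F(3) \<sigma>V[OF face] by simp
  qed
  show ?thesis
    unfolding Jideal
  proof (rule exI[of _ phi], intro conjI allI impI ballI is_phi unique exI[of _ \<zeta>] special)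
    show "ideal_gen (link \<Gamma> E') (\<zeta> ` {..<?d'}) = J" unfolding link' by (rule ideal)
    show "\<exists>\<pi>. bij_betw \<pi> {..<?d} {..<?d} \<and> (\<forall>i<?b. restr (link \<Gamma> E') (\<theta> (\<pi> i)) = \<zeta> i)"
      using \<pi>(1) \<zeta>_b by metis
    show "\<exists>q\<in>int_ideal \<Gamma> \<sigma> V E'. cong_mod (ideal_gen (link \<Gamma> E') (\<zeta> ` {..<?d'})) (phi p) q"
      if "p \<in> int_ideal \<Gamma> \<sigma> V E" for p
      unfolding link' ideal using int[OF that] cong_mod_J_refl[OF phi_mem[of p]] by (intro bexI[of _ "phi p"])
  qed
qed

end
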